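(* Let $(\Lambda,\mathbb F,R,A,t-1)$ be a 5-tuple satisfying the Standing Assumption (1)–(6) described in the context, with DE-data $\{P,\sigma,\delta,\tau\}$ of $A$ over $R$, and let $R_\lambda,A_\lambda,\gamma_\lambda,\gamma^A_\lambda$ be as there. Write $\overline a=\gamma_1(a)=a+(t-1)R$ for $a\in R$. (1) For each $\lambda\in\Lambda$, the deformation $A_\lambda$ of $A_1$ is a right double extension of $R_\lambda$ (over the base ring ${\bf k}$) with two variables $y_1,y_2$ and DE-data $\{P_\lambda,\sigma_\lambda,\delta_\lambda,\tau_\lambda\}$, where $$P_\lambda=\{p_{11}(\lambda),p_{12}(\lambda)\}\subset{\bf k},\qquad \tau_\lambda=\{\gamma_\lambda(\tau_1),\gamma_\lambda(\tau_2),\gamma_\lambda(\tau_0)\}\subset R_\lambda,$$ $$\sigma_\lambda=\begin{pmatrix}\gamma_\lambda\sigma_{11}\gamma_\lambda^{-1}&\gamma_\lambda\sigma_{12}\gamma_\lambda^{-1}\\ \gamma_\lambda\sigma_{21}\gamma_\lambda^{-1}&\gamma_\lambda\sigma_{22}\gamma_\lambda^{-1}\end{pmatrix},\qquad \delta_\lambda=\begin{pmatrix}\gamma_\lambda\delta_1\gamma_\lambda^{-1}\\ \gamma_\lambda\delta_2\gamma_\lambda^{-1}\end{pmatrix}.$$ (2) The semiclassical limit $A_1=R_1[y_1,y_2]$ is a Poisson ${\bf k}$-algebra containing $R_1$ as a Poisson subalgebra, with Poisson bracket satisfying $$\begin{aligned}\{y_2,y_1\}&=q_{11}y_1^2+q_{12}y_1y_2+w_1y_1+w_2y_2+w_0,\\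 \{y_1,a\}&=\alpha_{11}(a)y_1+\alpha_{12}(a)y_2+\nu_1(a),\\ \{y_2,a\}&=\alpha_{21}(a)y_1+\alpha_{22}(a)y_2+\nu_2(a)\end{aligned}$$ for all $a\in R_1$, where $$q_{11}=\overline{(t-1)^{-1}p_{11}(t)},\quad q_{12}=\overline{(t-1)^{-1}(p_{12}(t)-1)},\quad w_i=\overline{(t-1)^{-1}\tau_i}\ (i=0,1,2),$$ $$\begin{aligned}\alpha_{11}&=\gamma_1[(t-1)^{-1}(\sigma_{11}-I)]\gamma_1^{-1},&\alpha_{12}&=\gamma_1[(t-1)^{-1}\sigma_{12}]\gamma_1^{-1},\\ \alpha_{21}&=\gamma_1[(t-1)^{-1}\sigma_{21}]\gamma_1^{-1},&\alpha_{22}&=\gamma_1[(t-1)^{-1}(\sigma_{22}-I)]\gamma_1^{-1},\end{aligned}$$ $$\nu_1=\gamma_1[(t-1)^{-1}\delta_1]\gamma_1^{-1},\qquad \nu_2=\gamma_1[(t-1)^{-1}\delta_2]\gamma_1^{-1},$$ and $I$ denotes the identity map of $R$.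
   Context: ${\bf k}$ is a field of characteristic zero and $t$ is an indeterminate. A Poisson algebra is a commutative ${\bf k}$-algebra with a ${\bf k}$-bilinear bracket $\{-,-\}$ making it a Lie algebra and such that each $\{a,-\}$ is a derivation. Right double extension. Let $\mathbb F$ be a commutative ${\bf k}$-algebra and $R$ an $\mathbb F$-algebra. An $\mathbb F$-algebra $A$ containing $R$ as a subalgebra is a right double extension of $R$ if $A$ is generated by $R$ and two new variables $y_1,y_2$ such that (i) $y_2y_1=p_{11}y_1^2+p_{12}y_1y_2+\tau_1y_1+\tau_2y_2+\tau_0$ with $P:=\{p_{11},p_{12}\}\subset\mathbb F$ and $\tau:=\{\tau_1,\tau_2,\tau_0\}\subset R$; (ii) $A$ is a free left $R$-module with basis $\{y_1^iy_2^j\mid i,j\ge0\}$; (iii) $y_1R+y_2R+R\subset Ry_1+Ry_2+R$. Then there are $\mathbb F$-linear maps $\sigma_{ij},\delta_i:R\to R$ ($i,j\in\{1,2\}$) with $y_ia=\sigma_{i1}(a)y_1+\sigma_{i2}(a)y_2+\delta_i(a)$ for all $a\in R$; put $\sigma=(\sigma_{ij}):R\to M_{2\times2}(R)$ and $\delta=(\delta_1,\delta_2)^T:R\to M_{2\times1}(R)$. One calls $\{P,\sigma,\delta,\tau\}$ the DE-data of $A$. Standing Assumption on $(\Lambda,\mathbb F,R,A,t-1)$: (1) $\Lambda$ is a nonempty subset of ${\bf k}\setminus\{0,1\}$. (2) $\mathbb F$ is a ring with ${\bf k}[t,t^{-1}]\subset\mathbb F\subset\{f/g\in{\bf k}(t)\mid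 f,g\in{\bf k}[t],\ g(1)\ne0,\ g(\lambda)\neq0\ \forall\lambda\in\Lambda\}$. (3) $R$ is a (possibly noncommutative) $\mathbb F$-algebra. (4) $A$ is a right double extension of $R$ with variables $y_1,y_2$ and DE-data $\{P,\sigma,\delta,\tau\}$ such that $P=\{p_{11}(t),p_{12}(t)\}$ with $p_{11}(t),\,p_{12}(t)-1\in(t-1)\mathbb F$; $\tau=\{\tau_1,\tau_2,\tau_0\}\subset(t-1)R$; and for all $a\in R$, $\sigma(a)-\begin{pmatrix}a&0\\0&a\end{pmatrix}\in(t-1)M_{2\times2}(R)$ and $\delta(a)\in(t-1)M_{2\times1}(R)$. (5) $t-1$ is a nonzero, nonunit and non-zero-divisor of $A$ such that $R_1:=R/(t-1)R$ is commutative. (6) For $\lambda\in\Lambda\cup\{1\}$ set $R_\lambda:=R/(t-\lambda)R$, $A_\lambda:=A/(t-\lambda)A$, with canonical ${\bf k}$-algebra homomorphisms $\gamma_\lambda:R\to R_\lambda$ and $\gamma^A_\lambda:A\to A_\lambda$. Then $A_\lambda$ is a free left $R_\lambda$-module with basis $\{\gamma^A_\lambda(y_1)^i\gamma^A_\lambda(y_2)^j\mid i,j\ge0\}$. One still writes $y_1,y_2$ for $\gamma^A_\lambda(y_1),\gamma^A_\lambda(y_2)$. Notation: $\gamma_\lambda\sigma_{ij}\gamma_\lambda^{-1}$ denotes the (well-defined) map $R_\lambda\to R_\lambda$, $\gamma_\lambda(a)\mapsto\gamma_\lambda(\sigma_{ij}(a))$, and similarly for the other maps; $(t-1)^{-1}x$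 for $x\in (t-1)R$ (or $(t-1)\mathbb F$) is the unique element whose product with $t-1$ is $x$. Elements $f(t)\in\mathbb F$ have images in $R_\lambda$ identified with $f(\lambda)\in{\bf k}$. Here $A_1$ is commutative and is the polynomial ring $R_1[y_1,y_2]$. Semiclassical limit and deformation: if $h$ is a nonzero, nonunit, non-zero-divisor, central element of an algebra $B$ such that $B/hB$ is commutative, then $B/hB$ is a Poisson algebra with $\{\overline a,\overline b\}=\overline{h^{-1}(ab-ba)}$, called the semiclassical limit of $B$. This is the Poisson structure on $A_1$ and on $R_1$ (with $h=t-1$). The algebra $A_\lambda=A/(t-\lambda)A$, $\lambda\in\Lambda$, is called a deformation of $A_1$. *)

theory Defs
  imports "HOL-Algebra.Algebra" "HOL-Algebra.Algebraic_Closure_Type"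
begin

section \<open>Associative algebras and right double extensions\<close>

text \<open>The library locale \<^locale>\<open>algebra\<close> covers commutative algebras only; the following is
  its not necessarily commutative (unital, associative) counterpart.\<close>

definition assoc_algebra ::
    "('f, 'm) ring_scheme \<Rightarrow> ('f, 'b, 'n) module_scheme \<Rightarrow> bool" where
  "assoc_algebra F B \<longleftrightarrow> ring B \<and> module F B \<and>
     (\<forall>c\<in>carrier F. \<forall>x\<in>carrier B. \<forall>y\<in>carrier B.
        (c \<odot>\<^bsub>B\<^esub> x) \<otimes>\<^bsub>B\<^esub> y = c \<odot>\<^bsub>B\<^esub> (x \<otimes>\<^bsub>B\<^esub> y) \<and>
        x \<otimes>\<^bsub>B\<^esub> (c \<odot>\<^bsub>B\<^esub> y) = c \<odot>\<^bsub>B\<^esub> (x \<otimes>\<^bsub>B\<^esub> y))"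

definition linear_endo ::
    "('f, 'm) ring_scheme \<Rightarrow> ('f, 'b, 'n) module_scheme \<Rightarrow> ('b \<Rightarrow> 'b) \<Rightarrow> bool" where
  "linear_endo F B f \<longleftrightarrow> f \<in> carrier B \<rightarrow> carrier B \<and>
     (\<forall>x\<in>carrier B. \<forall>y\<in>carrier B. f (x \<oplus>\<^bsub>B\<^esub> y) = f x \<oplus>\<^bsub>B\<^esub> f y) \<and>
     (\<forall>c\<in>carrier F. \<forall>x\<in>carrier B. f (c \<odot>\<^bsub>B\<^esub> x) = c \<odot>\<^bsub>B\<^esub> f x)"

text \<open>``\<open>A\<close> contains \<open>R\<close> as a subalgebra'' is expressed by an injective algebra homomorphism
  \<open>\<iota> : R \<rightarrow> A\<close>, because quotients of \<open>R\<close> are not literally subsets of quotients of \<open>A\<close>.\<close>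

definition algebra_embedding ::
    "('f, 'm) ring_scheme \<Rightarrow> ('f, 'r, 'n) module_scheme \<Rightarrow> ('f, 'a, 'o) module_scheme
      \<Rightarrow> ('r \<Rightarrow> 'a) \<Rightarrow> bool" where
  "algebra_embedding F R A \<iota> \<longleftrightarrow> \<iota> \<in> ring_hom R A \<and> inj_on \<iota> (carrier R) \<and>
     (\<forall>c\<in>carrier F. \<forall>x\<in>carrier R. \<iota> (c \<odot>\<^bsub>R\<^esub> x) = c \<odot>\<^bsub>A\<^esub> \<iota> x)"

text \<open>\<open>A\<close>, as a left \<open>R\<close>-module via \<open>\<iota>\<close>, is free on the family \<open>y1\<^sup>i y2\<^sup>j\<close>.\<close>

definition free_on_monomials ::
    "('r, 'm) ring_scheme \<Rightarrow> ('a, 'n) ring_scheme \<Rightarrow> ('r \<Rightarrow> 'a) \<Rightarrow> 'a \<Rightarrow> 'a \<Rightarrow> bool" where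
  "free_on_monomials R A \<iota> y1 y2 \<longleftrightarrow>
     (\<forall>a\<in>carrier A. \<exists>!c :: nat \<times> nat \<Rightarrow> 'r.
        range c \<subseteq> carrier R \<and> finite {p. c p \<noteq> \<zero>\<^bsub>R\<^esub>} \<and>
        a = (\<Oplus>\<^bsub>A\<^esub>p\<in>{p. c p \<noteq> \<zero>\<^bsub>R\<^esub>}.
               \<iota> (c p) \<otimes>\<^bsub>A\<^esub> (y1 [^]\<^bsub>A\<^esub> fst p \<otimes>\<^bsub>A\<^esub> y2 [^]\<^bsub>A\<^esub> snd p)))"

definition DE_relation ::
    "('f, 'a, 'o) module_scheme \<Rightarrow> ('r \<Rightarrow> 'a) \<Rightarrow> 'a \<Rightarrow> 'a \<Rightarrow> 'f \<Rightarrow> 'f \<Rightarrow> (nat \<Rightarrow> 'r) \<Rightarrow> bool" where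
  "DE_relation A \<iota> y1 y2 p11 p12 \<tau> \<longleftrightarrow>
     y2 \<otimes>\<^bsub>A\<^esub> y1 =
       p11 \<odot>\<^bsub>A\<^esub> (y1 [^]\<^bsub>A\<^esub> (2::nat)) \<oplus>\<^bsub>A\<^esub> p12 \<odot>\<^bsub>A\<^esub> (y1 \<otimes>\<^bsub>A\<^esub> y2)
       \<oplus>\<^bsub>A\<^esub> \<iota> (\<tau> 1) \<otimes>\<^bsub>A\<^esub> y1 \<oplus>\<^bsub>A\<^esub> \<iota> (\<tau> 2) \<otimes>\<^bsub>A\<^esub> y2 \<oplus>\<^bsub>A\<^esub> \<iota> (\<tau> 0)"

definition right_double_extension ::
    "('f, 'm) ring_scheme \<Rightarrow> ('f, 'r, 'n) module_scheme \<Rightarrow> ('f, 'a, 'o) module_scheme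
      \<Rightarrow> ('r \<Rightarrow> 'a) \<Rightarrow> 'a \<Rightarrow> 'a \<Rightarrow> bool" where
  "right_double_extension F R A \<iota> y1 y2 \<longleftrightarrow>
     assoc_algebra F R \<and> assoc_algebra F A \<and> algebra_embedding F R A \<iota> \<and>
     y1 \<in> carrier A \<and> y2 \<in> carrier A \<and>
     generate_ring A (\<iota> ` carrier R \<union> {y1, y2}) = carrier A \<and>
     (\<exists>p11\<in>carrier F. \<exists>p12\<in>carrier F. \<exists>\<tau>\<in>{0, 1, 2} \<rightarrow> carrier R.
        DE_relation A \<iota> y1 y2 p11 p12 \<tau>) \<and>
     free_on_monomials R A \<iota> y1 y2 \<and>
     {y1 \<otimes>\<^bsub>A\<^esub> \<iota> a \<oplus>\<^bsub>A\<^esub> y2 \<otimes>\<^bsub>A\<^esub> \<iota> b \<oplus>\<^bsub>A\<^esub> \<iota> c | a b c.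
        a \<in> carrier R \<and> b \<in> carrier R \<and> c \<in> carrier R}
     \<subseteq> {\<iota> a \<otimes>\<^bsub>A\<^esub> y1 \<oplus>\<^bsub>A\<^esub> \<iota> b \<otimes>\<^bsub>A\<^esub> y2 \<oplus>\<^bsub>A\<^esub> \<iota> c | a b c.
        a \<in> carrier R \<and> b \<in> carrier R \<and> c \<in> carrier R}"

text \<open>\<open>R\<close> contains the image of \<open>F\<close>, so the subring generated by \<open>R\<close>, \<open>y1\<close>, \<open>y2\<close> is the
  generated \<open>F\<close>-subalgebra. In the DE-data, \<open>\<sigma> i j\<close> and \<open>\<delta> i\<close> are only
  relevant for \<open>i, j \<in> {1, 2}\<close>, and \<open>\<tau> i\<close> for \<open>i \<in> {0, 1, 2}\<close>.\<close>

definition right_double_extension_data ::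
    "('f, 'm) ring_scheme \<Rightarrow> ('f, 'r, 'n) module_scheme \<Rightarrow> ('f, 'a, 'o) module_scheme
      \<Rightarrow> ('r \<Rightarrow> 'a) \<Rightarrow> 'a \<Rightarrow> 'a \<Rightarrow> 'f \<Rightarrow> 'f \<Rightarrow> (nat \<Rightarrow> nat \<Rightarrow> 'r \<Rightarrow> 'r) \<Rightarrow> (nat \<Rightarrow> 'r \<Rightarrow> 'r)
      \<Rightarrow> (nat \<Rightarrow> 'r) \<Rightarrow> bool" where
  "right_double_extension_data F R A \<iota> y1 y2 p11 p12 \<sigma> \<delta> \<tau> \<longleftrightarrow>
     right_double_extension F R A \<iota> y1 y2 \<and>
     p11 \<in> carrier F \<and> p12 \<in> carrier F \<and> \<tau> \<in> {0, 1, 2} \<rightarrow> carrier R \<and>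
     DE_relation A \<iota> y1 y2 p11 p12 \<tau> \<and>
     (\<forall>i\<in>{1, 2}. \<forall>j\<in>{1, 2}. linear_endo F R (\<sigma> i j)) \<and>
     (\<forall>i\<in>{1, 2}. linear_endo F R (\<delta> i)) \<and>
     (\<forall>a\<in>carrier R.
        y1 \<otimes>\<^bsub>A\<^esub> \<iota> a = \<iota> (\<sigma> 1 1 a) \<otimes>\<^bsub>A\<^esub> y1 \<oplus>\<^bsub>A\<^esub> \<iota> (\<sigma> 1 2 a) \<otimes>\<^bsub>A\<^esub> y2 \<oplus>\<^bsub>A\<^esub> \<iota> (\<delta> 1 a) \<and>
        y2 \<otimes>\<^bsub>A\<^esub> \<iota> a = \<iota> (\<sigma> 2 1 a) \<otimes>\<^bsub>A\<^esub> y1 \<oplus>\<^bsub>A\<^esub> \<iota> (\<sigma> 2 2 a) \<otimes>\<^bsub>A\<^esub> y2 \<oplus>\<^bsub>A\<^esub> \<iota> (\<delta> 2 a))"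


section \<open>Poisson algebras and semiclassical limits\<close>

definition poisson_algebra ::
    "('k, 'm) ring_scheme \<Rightarrow> ('k, 'b, 'n) module_scheme \<Rightarrow> ('b \<Rightarrow> 'b \<Rightarrow> 'b) \<Rightarrow> bool" where
  "poisson_algebra K B br \<longleftrightarrow> algebra K B \<and>
     (\<forall>x\<in>carrier B. \<forall>y\<in>carrier B. br x y \<in> carrier B) \<and>
     (\<forall>x\<in>carrier B. \<forall>y\<in>carrier B. \<forall>z\<in>carrier B.
        br (x \<oplus>\<^bsub>B\<^esub> y) z = br x z \<oplus>\<^bsub>B\<^esub> br y z \<and>
        br z (x \<oplus>\<^bsub>B\<^esub> y) = br z x \<oplus>\<^bsub>B\<^esub> br z y) \<and>
     (\<forall>c\<in>carrier K. \<forall>x\<in>carrier B. \<forall>y\<in>carrier B.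
        br (c \<odot>\<^bsub>B\<^esub> x) y = c \<odot>\<^bsub>B\<^esub> br x y \<and> br x (c \<odot>\<^bsub>B\<^esub> y) = c \<odot>\<^bsub>B\<^esub> br x y) \<and>
     (\<forall>x\<in>carrier B. br x x = \<zero>\<^bsub>B\<^esub>) \<and>
     (\<forall>x\<in>carrier B. \<forall>y\<in>carrier B. \<forall>z\<in>carrier B.
        br x (br y z) \<oplus>\<^bsub>B\<^esub> br y (br z x) \<oplus>\<^bsub>B\<^esub> br z (br x y) = \<zero>\<^bsub>B\<^esub>) \<and>
     (\<forall>x\<in>carrier B. \<forall>y\<in>carrier B. \<forall>z\<in>carrier B.
        br x (y \<otimes>\<^bsub>B\<^esub> z) = br x y \<otimes>\<^bsub>B\<^esub> z \<oplus>\<^bsub>B\<^esub> y \<otimes>\<^bsub>B\<^esub> br x z)"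

definition poisson_subalgebra ::
    "('k, 'm) ring_scheme \<Rightarrow> ('k, 'r, 'n) module_scheme \<Rightarrow> ('r \<Rightarrow> 'r \<Rightarrow> 'r)
      \<Rightarrow> ('k, 'b, 'o) module_scheme \<Rightarrow> ('b \<Rightarrow> 'b \<Rightarrow> 'b) \<Rightarrow> ('r \<Rightarrow> 'b) \<Rightarrow> bool" where
  "poisson_subalgebra K R brR B brB \<iota> \<longleftrightarrow>
     poisson_algebra K R brR \<and> poisson_algebra K B brB \<and> algebra_embedding K R B \<iota> \<and>
     (\<forall>x\<in>carrier R. \<forall>y\<in>carrier R. \<iota> (brR x y) = brB (\<iota> x) (\<iota> y))"

text \<open>\<open>B\<close> is the polynomial ring in the two commuting indeterminates \<open>y1\<close>, \<open>y2\<close> over the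
  commutative ring \<open>R\<close> (embedded by \<open>\<iota>\<close>).\<close>

definition is_polynomial_ring2 ::
    "('r, 'm) ring_scheme \<Rightarrow> ('b, 'n) ring_scheme \<Rightarrow> ('r \<Rightarrow> 'b) \<Rightarrow> 'b \<Rightarrow> 'b \<Rightarrow> bool" where
  "is_polynomial_ring2 R B \<iota> y1 y2 \<longleftrightarrow> cring R \<and> cring B \<and>
     \<iota> \<in> ring_hom R B \<and> inj_on \<iota> (carrier R) \<and> y1 \<in> carrier B \<and> y2 \<in> carrier B \<and>
     free_on_monomials R B \<iota> y1 y2"

text \<open>For central \<open>h\<close>, the ideal \<open>hB\<close> is the left coset \<open>h <#\<^bsub>B\<^esub> carrier B\<close>.\<close>

definition nonzero_nonunit_regular :: "('b, 'm) ring_scheme \<Rightarrow> 'b \<Rightarrow> bool" where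
  "nonzero_nonunit_regular B h \<longleftrightarrow> h \<in> carrier B \<and> h \<noteq> \<zero>\<^bsub>B\<^esub> \<and> h \<notin> Units B \<and>
     (\<forall>x\<in>carrier B. h \<otimes>\<^bsub>B\<^esub> x = \<zero>\<^bsub>B\<^esub> \<or> x \<otimes>\<^bsub>B\<^esub> h = \<zero>\<^bsub>B\<^esub> \<longrightarrow> x = \<zero>\<^bsub>B\<^esub>)"

definition has_semiclassical_limit :: "('b, 'm) ring_scheme \<Rightarrow> 'b \<Rightarrow> bool" where
  "has_semiclassical_limit B h \<longleftrightarrow> nonzero_nonunit_regular B h \<and>
     (\<forall>x\<in>carrier B. h \<otimes>\<^bsub>B\<^esub> x = x \<otimes>\<^bsub>B\<^esub> h) \<and> cring (B Quot (h <#\<^bsub>B\<^esub> carrier B))"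

text \<open>\<open>h\<^sup>-\<^sup>1 x\<close> for \<open>x \<in> hB\<close> and regular \<open>h\<close>.\<close>

definition div_by :: "('b, 'm) ring_scheme \<Rightarrow> 'b \<Rightarrow> 'b \<Rightarrow> 'b" where
  "div_by B h x = (THE y. y \<in> carrier B \<and> h \<otimes>\<^bsub>B\<^esub> y = x)"

text \<open>The arguments \<open>U\<close>, \<open>V\<close> are cosets of \<open>hB\<close>; the value is the common coset of all
  \<open>h\<^sup>-\<^sup>1(ab - ba)\<close> with \<open>a \<in> U\<close>, \<open>b \<in> V\<close>.\<close>

definition semiclassical_bracket ::
    "('b, 'm) ring_scheme \<Rightarrow> 'b \<Rightarrow> 'b set \<Rightarrow> 'b set \<Rightarrow> 'b set" where
  "semiclassical_bracket B h U V =
     the_elem {(h <#\<^bsub>B\<^esub> carrier B) +>\<^bsub>B\<^esub> div_by B h (a \<otimes>\<^bsub>B\<^esub> b \<ominus>\<^bsub>B\<^esub> b \<otimes>\<^bsub>B\<^esub> a) | a b.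
                 a \<in> U \<and> b \<in> V}"


section \<open>Specialisation at points of the base field\<close>

text \<open>The field of characteristic zero is the type \<open>'k\<close>, the rational function field \<open>k(t)\<close> is
  \<open>'k poly fract\<close>, and a ring \<open>F\<close> between \<open>k[t, 1/t]\<close> and \<open>k(t)\<close> is a subset of the latter,
  made into a ring record by \<open>fract_subring\<close>.\<close>

abbreviation base_field :: "'k::field_char_0 ring" where
  "base_field \<equiv> ring_of_type_algebra"

abbreviation fract_subring :: "'k::field_char_0 poly fract set \<Rightarrow> 'k poly fract ring" where
  "fract_subring F \<equiv> ring_of_type_algebra\<lparr>carrier := F\<rparr>"

definition t_minus :: "'k::field_char_0 \<Rightarrow> 'k poly fract" where
  "t_minus \<mu> = to_fract [:- \<mu>, 1:]"

definition laurent_polys :: "'k::field_char_0 poly fract set" where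
  "laurent_polys = {to_fract f / to_fract [:0, 1:] ^ n | f n. True}"

definition regular_at :: "'k::field_char_0 set \<Rightarrow> 'k poly fract set" where
  "regular_at S = {to_fract f / to_fract g | f g. \<forall>\<mu>\<in>S. poly g \<mu> \<noteq> 0}"

text \<open>The value \<open>x(\<mu>)\<close> of a rational function \<open>x\<close> whose denominator does not vanish at \<open>\<mu>\<close>.\<close>

definition fract_eval :: "'k::field_char_0 \<Rightarrow> 'k poly fract \<Rightarrow> 'k" where
  "fract_eval \<mu> x = (THE c. \<exists>f g. poly g \<mu> \<noteq> 0 \<and> x = to_fract f / to_fract g \<and>
                                 c = poly f \<mu> / poly g \<mu>)"

text \<open>The element \<open>t - \<mu>\<close> of an algebra \<open>B\<close>, and the ideal \<open>(t - \<mu>)B\<close>.\<close>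

definition t_minus_in ::
    "('k::field_char_0 poly fract, 'b, 'm) module_scheme \<Rightarrow> 'k \<Rightarrow> 'b" where
  "t_minus_in B \<mu> = t_minus \<mu> \<odot>\<^bsub>B\<^esub> \<one>\<^bsub>B\<^esub>"

definition spec_ideal ::
    "('k::field_char_0 poly fract, 'b, 'm) module_scheme \<Rightarrow> 'k \<Rightarrow> 'b set" where
  "spec_ideal B \<mu> = t_minus_in B \<mu> <#\<^bsub>B\<^esub> carrier B"

text \<open>\<open>spec_algebra B \<mu>\<close> is \<open>B\<^sub>\<mu> = B/(t - \<mu>)B\<close> as a \<open>k\<close>-algebra, and \<open>spec_proj B \<mu>\<close> is the canonical map
  \<open>\<gamma>\<^sub>\<mu> : B \<rightarrow> B\<^sub>\<mu>\<close>.\<close>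

definition spec_proj ::
    "('k::field_char_0 poly fract, 'b, 'm) module_scheme \<Rightarrow> 'k \<Rightarrow> 'b \<Rightarrow> 'b set" where
  "spec_proj B \<mu> a = spec_ideal B \<mu> +>\<^bsub>B\<^esub> a"

definition spec_algebra ::
    "('k::field_char_0 poly fract, 'b, 'm) module_scheme \<Rightarrow> 'k \<Rightarrow> ('k, 'b set) module" where
  "spec_algebra B \<mu> = ring.extend (B Quot spec_ideal B \<mu>)
     (module.fields (\<lambda>c U. \<Union>x\<in>U. spec_proj B \<mu> (to_fract [:c:] \<odot>\<^bsub>B\<^esub> x)))"

text \<open>For \<open>f : B \<rightarrow> C\<close>, the induced map \<open>\<gamma>\<^sub>\<mu> f \<gamma>\<^sub>\<mu>\<^sup>-\<^sup>1 : B\<^sub>\<mu> \<rightarrow> C\<^sub>\<mu>\<close>: a coset \<open>U = \<gamma>\<^sub>\<mu>(a)\<close> is sent to the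
  unique member \<open>\<gamma>\<^sub>\<mu>(f(a))\<close> of \<open>\<gamma>\<^sub>\<mu>(f(U))\<close>.\<close>

definition spec_map ::
    "('k::field_char_0 poly fract, 'c, 'm) module_scheme \<Rightarrow> 'k \<Rightarrow> ('b \<Rightarrow> 'c) \<Rightarrow> 'b set \<Rightarrow> 'c set" where
  "spec_map C \<mu> f U = the_elem ((\<lambda>x. spec_proj C \<mu> (f x)) ` U)"


definition standing_assumption ::
    "'k::field_char_0 set \<Rightarrow> 'k poly fract set \<Rightarrow> ('k poly fract, 'r) module
      \<Rightarrow> ('k poly fract, 'a) module \<Rightarrow> ('r \<Rightarrow> 'a) \<Rightarrow> 'a \<Rightarrow> 'a \<Rightarrow> 'k poly fract \<Rightarrow> 'k poly fract
      \<Rightarrow> (nat \<Rightarrow> nat \<Rightarrow> 'r \<Rightarrow> 'r) \<Rightarrow> (nat \<Rightarrow> 'r \<Rightarrow> 'r) \<Rightarrow> (nat \<Rightarrow> 'r) \<Rightarrow> bool" where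
  "standing_assumption \<Lambda> F R A \<iota> y1 y2 p11 p12 \<sigma> \<delta> \<tau> \<longleftrightarrow>
     \<Lambda> \<noteq> {} \<and> \<Lambda> \<subseteq> UNIV - {0, 1} \<and>
     subring F ring_of_type_algebra \<and> laurent_polys \<subseteq> F \<and> F \<subseteq> regular_at (insert 1 \<Lambda>) \<and>
     assoc_algebra (fract_subring F) R \<and>
     right_double_extension_data (fract_subring F) R A \<iota> y1 y2 p11 p12 \<sigma> \<delta> \<tau> \<and>
       p11 \<in> (\<lambda>x. t_minus 1 * x) ` F \<and> p12 - 1 \<in> (\<lambda>x. t_minus 1 * x) ` F \<and>
       (\<forall>i\<in>{0, 1, 2}. \<tau> i \<in> spec_ideal R 1) \<and>
       (\<forall>a\<in>carrier R.
          \<sigma> 1 1 a \<ominus>\<^bsub>R\<^esub> a \<in> spec_ideal R 1 \<and> \<sigma> 1 2 a \<in> spec_ideal R 1 \<and>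
          \<sigma> 2 1 a \<in> spec_ideal R 1 \<and> \<sigma> 2 2 a \<ominus>\<^bsub>R\<^esub> a \<in> spec_ideal R 1 \<and>
          \<delta> 1 a \<in> spec_ideal R 1 \<and> \<delta> 2 a \<in> spec_ideal R 1) \<and>
     nonzero_nonunit_regular A (t_minus_in A 1) \<and> cring (spec_algebra R 1) \<and>
     (\<forall>\<mu>\<in>insert 1 \<Lambda>.
        free_on_monomials (spec_algebra R \<mu>) (spec_algebra A \<mu>) (spec_map A \<mu> \<iota>)
          (spec_proj A \<mu> y1) (spec_proj A \<mu> y2))"

end

theory Submission
  imports Defs
begin

text \<open>Everything descends along the canonical projections \<open>B \<rightarrow> B/(t - \<mu>)B\<close>. The generation, the
  relations and the commutation rules of \<open>A\<close> project directly, and \<open>f \<in> F\<close> acts on the quotient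
  as the scalar \<open>f(\<mu>)\<close>; injectivity of \<open>R\<^sub>\<mu> \<rightarrow> A\<^sub>\<mu>\<close> is the uniqueness of coefficients in the
  monomial basis. At \<open>\<mu> = 1\<close> the generators of \<open>A\<^sub>1\<close> commute, and the Poisson axioms for
  \<open>d(x, y) = h\<^sup>-\<^sup>1(xy - yx)\<close>, where \<open>h = t - 1\<close>, are the commutator identities of \<open>B\<close> with powers of the
  regular central element \<open>h\<close> cancelled; the formulas for the bracket are the defining relations of
  \<open>A\<close> divided by \<open>h\<close>.\<close>


section \<open>Rational functions regular at a point\<close>

text \<open>The Euclidean algorithm, one division step at a time. The Bezout identity is stated for
  the cofactors \<open>u'\<close>, \<open>v'\<close> and not for \<open>d\<close>, because it serves
  to bring a fraction \<open>u/v\<close> to lowest terms and then to invert its denominator.\<close>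

lemma poly_coprime_representation:
  fixes u v :: "'k::field poly"
  assumes "u \<noteq> 0 \<or> v \<noteq> 0"
  shows "\<exists>d u' v' a b. u = d * u' \<and> v = d * v' \<and> a * u' + b * v' = 1"
  using assms
\<comment> \<open>The measure ranks \<open>v = 0\<close> below the nonzero constants, which have the
  same degree.\<close>
proof (induction "if v = 0 then 0 else Suc (degree v)" arbitrary: u v rule: less_induct)
  case less
  show ?case
  proof (cases "v = 0")
    case True
    have "u = u * 1 \<and> v = u * 0 \<and> 1 * (1::'k poly) + 0 * 0 = 1" using True by simp
    then show ?thesis by blast
  next
    case False
    have "u mod v = 0 \<or> degree (u mod v) < degree v"
      using degree_mod_less[OF False] by blast
    then have "\<exists>d u' v' a b. v = d * u' \<and> u mod v = d * v' \<and> a * u' + b * v' = 1"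
      using False by (intro less.hyps) auto
    then obtain d u' v' a b where *: "v = d * u'" "u mod v = d * v'" "a * u' + b * v' = 1"
      by blast
    have "u = v * (u div v) + u mod v" by simp
    also have "\<dots> = d * (u' * (u div v) + v')" using * by (simp add: algebra_simps)
    finally have "u = d * (u' * (u div v) + v')" .
    \<comment> \<open>Substitute \<open>v' = (u' * q + v') - u' * q\<close>, where
      \<open>q = u div v\<close>, into the identity for the smaller pair.\<close>
    moreover have "b * (u' * (u div v) + v') + (a - b * (u div v)) * u' = 1"
      using *(3) by (simp add: algebra_simps)
    ultimately show ?thesis using *(1) by blast
  qed
qed

text \<open>Two representations of the same fraction satisfy \<open>f * g' = f' * g\<close> as
  polynomials. Evaluating this at \<mu>, where neither denominator vanishes, shows that the value
  does not depend on the representation.\<close>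

lemma fract_eval_eqI:
  assumes "poly g \<mu> \<noteq> 0" "x = to_fract f / to_fract g"
  shows "fract_eval \<mu> x = poly f \<mu> / poly g \<mu>"
  unfolding fract_eval_def
proof (rule the_equality)
  fix c assume "\<exists>f g. poly g \<mu> \<noteq> 0 \<and> x = to_fract f / to_fract g \<and> c = poly f \<mu> / poly g \<mu>"
  then obtain f' g' where *: "poly g' \<mu> \<noteq> 0" "x = to_fract f' / to_fract g'"
    "c = poly f' \<mu> / poly g' \<mu>" by blast
  have "g \<noteq> 0" "g' \<noteq> 0" using assms * by auto
  then have "to_fract (f * g') = to_fract (f' * g)"
    using assms(2) *(2) by (simp add: field_simps)
  then have "poly (f * g') \<mu> = poly (f' * g) \<mu>" by (simp only: to_fract_eq_iff)
  then show "c = poly f \<mu> / poly g \<mu>" unfolding *(3) using *(1) assms(1)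
    by (simp add: frac_eq_eq)
qed (use assms in blast)

lemma fract_subring_simps [simp]:
  "carrier (fract_subring F) = F" "x \<otimes>\<^bsub>fract_subring F\<^esub> y = x * y"
  "x \<oplus>\<^bsub>fract_subring F\<^esub> y = x + y" "\<one>\<^bsub>fract_subring F\<^esub> = 1" "\<zero>\<^bsub>fract_subring F\<^esub> = 0"
  by (simp_all add: ring_of_type_algebra_def)

lemma base_field_simps [simp]:
  "carrier base_field = UNIV" "x \<otimes>\<^bsub>base_field\<^esub> y = x * y"
  "x \<oplus>\<^bsub>base_field\<^esub> y = x + y" "\<one>\<^bsub>base_field\<^esub> = 1" "\<zero>\<^bsub>base_field\<^esub> = 0"
  by (simp_all add: ring_of_type_algebra_def)

lemma cring_iff_ring_commute:
  "cring Q \<longleftrightarrow> ring Q \<and> (\<forall>x\<in>carrier Q. \<forall>y\<in>carrier Q. x \<otimes>\<^bsub>Q\<^esub> y = y \<otimes>\<^bsub>Q\<^esub> x)"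
  by (auto simp: cring_def comm_monoid_def comm_monoid_axioms_def ring.is_monoid)

locale base_ring =
  fixes F :: "'k::field_char_0 poly fract set"
  assumes subring: "subring F ring_of_type_algebra" and laurent: "laurent_polys \<subseteq> F"
begin

lemma to_fract_in [simp]: "to_fract f \<in> F"
proof -
  have "to_fract f = to_fract f / to_fract [:0, 1:] ^ 0" by simp
  then show ?thesis using laurent unfolding laurent_polys_def by blast
qed

lemma t_minus_in [simp]: "t_minus \<mu> \<in> F"
  by (simp add: t_minus_def)

lemma mult_in: "x \<in> F \<Longrightarrow> y \<in> F \<Longrightarrow> x * y \<in> F"
  and add_in: "x \<in> F \<Longrightarrow> y \<in> F \<Longrightarrow> x + y \<in> F"
  using subringE(6,7)[OF subring] by (auto simp: ring_of_type_algebra_def)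

text \<open>By Bezout, \<open>F\<close> contains \<open>1/g\<close> together with every reduced fraction \<open>f/g\<close>; hence
  \<open>F/(t - \<mu>)F = k\<close>.\<close>

lemma t_minus_dvd_diff_eval:
  assumes x: "x \<in> F" and reg: "x \<in> regular_at S" and \<mu>: "\<mu> \<in> S"
  obtains y where "y \<in> F" "x = to_fract [:fract_eval \<mu> x:] + t_minus \<mu> * y"
proof -
  obtain f g where fg: "poly g \<mu> \<noteq> 0" "x = to_fract f / to_fract g"
    using reg \<mu> unfolding regular_at_def by blast
  then have g0: "g \<noteq> 0" by auto
  then obtain d u v a b where *: "f = d * u" "g = d * v" "a * u + b * v = 1"
    using poly_coprime_representation by metis
  have v: "poly v \<mu> \<noteq> 0" "v \<noteq> 0" "d \<noteq> 0" using fg(1) g0 * by auto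
  have xv: "x = to_fract u / to_fract v" using fg(2) * v by simp
  have ev: "fract_eval \<mu> x = poly u \<mu> / poly v \<mu>" by (rule fract_eval_eqI[OF v(1) xv])
  \<comment> \<open>Lowest terms matter here: \<open>1/v\<close> is a polynomial combination of
    \<open>x\<close> and \<open>1\<close> and so lies in \<open>F\<close>, whereas the inverse of
    the original denominator \<open>g\<close> may lie outside \<open>F\<close>.\<close>
  have "1 / to_fract v = to_fract (a * u + b * v) / to_fract v" using *(3) by simp
  also have "\<dots> = to_fract a * x + to_fract b"
    using v by (simp add: xv add_divide_distrib)
  also have "\<dots> \<in> F" using x by (intro add_in mult_in) auto
  finally have iv: "1 / to_fract v \<in> F" .
  \<comment> \<open>The constant is the value of \<open>u/v\<close> at \<mu>, so this difference
    vanishes at \<mu> and yields the factor \<open>t - \<mu>\<close>.\<close>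
  have "poly (u - [:fract_eval \<mu> x:] * v) \<mu> = 0" using v ev by simp
  then have "[:- \<mu>, 1:] dvd u - [:fract_eval \<mu> x:] * v" by (simp only: poly_eq_0_iff_dvd)
  then obtain w where w: "u - [:fract_eval \<mu> x:] * v = [:- \<mu>, 1:] * w" by (elim dvdE)
  have "to_fract u = to_fract ([:fract_eval \<mu> x:] * v + [:- \<mu>, 1:] * w)"
    using w by (simp only: to_fract_eq_iff) (metis add.commute diff_add_cancel)
  then have "x = to_fract [:fract_eval \<mu> x:] + t_minus \<mu> * (to_fract w * (1 / to_fract v))"
    unfolding to_fract_add to_fract_mult t_minus_def using v
    by (subst xv) (simp add: add_divide_distrib)
  moreover have "to_fract w * (1 / to_fract v) \<in> F" using iv by (intro mult_in) auto
  ultimately show ?thesis using that by blast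
qed

end


section \<open>Specialisation of an algebra\<close>

locale specialisation = base_ring F + ring B
  for F :: "'k::field_char_0 poly fract set"
    and B :: "('k poly fract, 'b, 'm) module_scheme" (structure) +
  fixes \<mu> :: 'k
  assumes alg: "assoc_algebra (fract_subring F) B"
begin

abbreviation "h \<equiv> t_minus_in B \<mu>"
abbreviation "J \<equiv> spec_ideal B \<mu>"
abbreviation "S \<equiv> spec_algebra B \<mu>"
abbreviation "\<gamma> \<equiv> spec_proj B \<mu>"

lemma module_B: "module (fract_subring F) B"
  using alg by (simp add: assoc_algebra_def)

lemmas smult_closed [simp] = module.smult_closed[OF module_B, simplified fract_subring_simps]
  and smult_l_distr = module.smult_l_distr[OF module_B, simplified fract_subring_simps]
  and smult_r_distr = module.smult_r_distr[OF module_B, simplified fract_subring_simps]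
  and smult_assoc = module.smult_assoc1[OF module_B, simplified fract_subring_simps]
  and smult_one [simp] = module.smult_one[OF module_B, simplified fract_subring_simps]

lemma smult_mult_left: "c \<in> F \<Longrightarrow> x \<in> carrier B \<Longrightarrow> y \<in> carrier B \<Longrightarrow> (c \<odot> x) \<otimes> y = c \<odot> (x \<otimes> y)"
  and smult_mult_right: "c \<in> F \<Longrightarrow> x \<in> carrier B \<Longrightarrow> y \<in> carrier B \<Longrightarrow> x \<otimes> (c \<odot> y) = c \<odot> (x \<otimes> y)"
  using alg by (simp_all add: assoc_algebra_def)

lemma smult_minus:
  assumes "c \<in> F" "x \<in> carrier B" "y \<in> carrier B"
  shows "c \<odot> (x \<ominus> y) = c \<odot> x \<ominus> c \<odot> y"
proof -
  have "c \<odot> z = (c \<odot> \<one>) \<otimes> z" if "z \<in> carrier B" for z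
    using that assms by (simp add: smult_mult_left)
  from this[of x] this[of y] this[of "x \<ominus> y"] show ?thesis
    using assms by (simp add: minus_eq r_distr r_minus)
qed

lemma h_closed [simp]: "h \<in> carrier B"
  by (simp add: t_minus_in_def)

lemma h_mult: "x \<in> carrier B \<Longrightarrow> h \<otimes> x = t_minus \<mu> \<odot> x"
  by (simp add: t_minus_in_def smult_mult_left)

lemma h_central: "x \<in> carrier B \<Longrightarrow> x \<otimes> h = h \<otimes> x"
  by (simp add: t_minus_in_def smult_mult_left smult_mult_right)

lemma J_eq: "J = {h \<otimes> x | x. x \<in> carrier B}"
  unfolding spec_ideal_def l_coset_def by auto

lemma J_E:
  assumes "x \<in> J"
  obtains y where "y \<in> carrier B" "x = h \<otimes> y"
  using assms unfolding J_eq by blast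

lemma J_I [intro]: "x \<in> carrier B \<Longrightarrow> h \<otimes> x \<in> J"
  by (auto simp: J_eq)

text \<open>Being a scalar multiple of one, \<open>h\<close> is central, so its left coset absorbs
  products from both sides.\<close>

lemma ideal_J: "ideal J B"
proof (rule idealI)
  show "subgroup J (add_monoid B)"
  proof (rule add.subgroupI)
    show "J \<subseteq> carrier B" "J \<noteq> {}" by (auto simp: J_eq)
    show "\<ominus> a \<in> J" if "a \<in> J" for a using that J_I by (fastforce simp: J_eq simp flip: r_minus)
    show "a \<oplus> b \<in> J" if "a \<in> J" "b \<in> J" for a b
      using that by (auto simp: J_eq simp flip: r_distr)
  qed
  fix a x assume ax: "a \<in> J" "x \<in> carrier B"
  then obtain b where b: "b \<in> carrier B" "a = h \<otimes> b" by (auto simp: J_eq)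
  show "a \<otimes> x \<in> J" using b ax by (auto simp: m_assoc)
  have "x \<otimes> a = h \<otimes> (x \<otimes> b)" using b ax h_central[of x] by (simp flip: m_assoc)
  then show "x \<otimes> a \<in> J" using b ax by auto
qed (rule ring_axioms)

sublocale J: ideal J B by (rule ideal_J)

lemma S_simps:
  "carrier S = carrier (B Quot J)" "monoid.mult S = monoid.mult (B Quot J)"
  "monoid.one S = monoid.one (B Quot J)" "ring.zero S = ring.zero (B Quot J)" "ring.add S = ring.add (B Quot J)"
  by (simp_all add: spec_algebra_def ring.defs)

text \<open>\<open>spec_algebra\<close> extends the record of the quotient ring by a scalar
  multiplication, so the ring axioms are carried over operation by operation.\<close>

lemma ring_S: "ring S"
proof -
  interpret Q: ring "B Quot J" by (rule J.quotient_is_ring)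
  show ?thesis
  proof (intro ringI abelian_groupI monoidI)
    fix x assume "x \<in> carrier S"
    then show "\<exists>y\<in>carrier S. y \<oplus>\<^bsub>S\<^esub> x = \<zero>\<^bsub>S\<^esub>"
      by (intro bexI[of _ "\<ominus>\<^bsub>B Quot J\<^esub> x"]) (simp_all add: S_simps Q.l_neg)
  qed (simp_all add: S_simps Q.m_assoc Q.l_distr Q.r_distr Q.a_assoc Q.a_comm Q.a_lcomm)
qed

lemma cring_S_iff: "cring S \<longleftrightarrow> cring (B Quot J)"
  unfolding cring_iff_ring_commute using J.quotient_is_ring ring_S by (simp add: S_simps)

sublocale S: ring S by (rule ring_S)

lemma carrier_S: "carrier S = \<gamma> ` carrier B"
  by (auto simp: S_simps FactRing_simps spec_proj_def)

lemma proj_closed [simp]: "x \<in> carrier B \<Longrightarrow> \<gamma> x \<in> carrier S"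
  by (simp add: carrier_S)

lemma proj_hom: "\<gamma> \<in> ring_hom B S"
  using J.rcos_ring_hom by (simp add: ring_hom_def S_simps spec_proj_def[abs_def])

sublocale proj: ring_hom_ring B S \<gamma>
  by (intro ring_hom_ringI2 ring_axioms ring_S proj_hom)

lemma proj_eq_iff: "x \<in> carrier B \<Longrightarrow> y \<in> carrier B \<Longrightarrow> \<gamma> x = \<gamma> y \<longleftrightarrow> x \<ominus> y \<in> J"
  unfolding spec_proj_def by (rule quotient_eq_iff_same_a_r_cos[OF ideal_J, symmetric])

lemma mem_proj_iff: "x \<in> carrier B \<Longrightarrow> y \<in> \<gamma> x \<longleftrightarrow> y \<in> carrier B \<and> \<gamma> y = \<gamma> x"
  unfolding spec_proj_def
  by (metis J.a_elemrcos_carrier J.a_rcos_self J.a_repr_independence')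

text \<open>Acting by \<open>c\<close> is multiplication by the element
  \<open>c \<odot> \<one>\<close>, and the projection is multiplicative.\<close>

lemma proj_smult_cong:
  assumes "c \<in> F" "x \<in> carrier B" "y \<in> carrier B" "\<gamma> x = \<gamma> y"
  shows "\<gamma> (c \<odot> x) = \<gamma> (c \<odot> y)"
proof -
  have "\<gamma> (c \<odot> z) = \<gamma> (c \<odot> \<one>) \<otimes>\<^bsub>S\<^esub> \<gamma> z" if "z \<in> carrier B" for z
    using that assms(1) by (simp add: smult_mult_left flip: proj.hom_mult)
  from this[of x] this[of y] show ?thesis using assms by simp
qed

text \<open>The union that defines the scalar multiplication runs over a coset all of whose members
  contribute the same class, so it collapses to that class.\<close>

lemma smult_S: 
  assumes "x \<in> carrier B"
  shows "c \<odot>\<^bsub>S\<^esub> \<gamma> x = \<gamma> (to_fract [:c:] \<odot> x)"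
proof -
  have "c \<odot>\<^bsub>S\<^esub> \<gamma> x = (\<Union>y\<in>\<gamma> x. \<gamma> (to_fract [:c:] \<odot> y))"
    by (simp add: spec_algebra_def ring.defs module.defs)
  also have "\<dots> = (\<Union>y\<in>\<gamma> x. \<gamma> (to_fract [:c:] \<odot> x))"
    using assms by (intro SUP_cong refl proj_smult_cong) (auto simp: mem_proj_iff)
  also have "\<dots> = \<gamma> (to_fract [:c:] \<odot> x)" using assms mem_proj_iff[of x x] by auto
  finally show ?thesis .
qed

text \<open>Modulo \<open>(t - \<mu>)F\<close> the scalar \<open>f\<close> is the constant
  \<open>f(\<mu>)\<close>, and a multiple of \<open>t - \<mu>\<close> acts through \<open>h\<close>,
  which dies in the quotient.\<close>

lemma proj_smult_eval:
  assumes "f \<in> F" "f \<in> regular_at M" "\<mu> \<in> M" "x \<in> carrier B"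
  shows "\<gamma> (f \<odot> x) = fract_eval \<mu> f \<odot>\<^bsub>S\<^esub> \<gamma> x"
proof -
  obtain g where g: "g \<in> F" "f = to_fract [:fract_eval \<mu> f:] + t_minus \<mu> * g"
    using t_minus_dvd_diff_eval[OF assms(1-3)] by blast
  have "f \<odot> x = to_fract [:fract_eval \<mu> f:] \<odot> x \<oplus> h \<otimes> (g \<odot> x)"
    using assms g(1) by (subst (1) g(2)) (simp add: smult_l_distr smult_assoc mult_in h_mult)
  moreover have "\<gamma> (h \<otimes> (g \<odot> x)) = \<zero>\<^bsub>S\<^esub>"
    using proj_eq_iff[of "h \<otimes> (g \<odot> x)" \<zero>] J_I[of "g \<odot> x"] g assms
    by (simp add: minus_eq)
  ultimately show ?thesis using g assms by (simp add: smult_S)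
qed

lemma cring_base: "cring (base_field :: 'k ring)"
  by (rule cring_from_type_algebra)

lemma to_fract_const_simps: 
  "to_fract [:c + d:] = to_fract [:c:] + to_fract [:d:]"
  "to_fract [:c * d:] = to_fract [:c:] * to_fract [:d:]"
  by (simp_all flip: to_fract_add to_fract_mult)

lemma to_fract_const_1: "to_fract [:1:] = 1"
  by (simp only: pCons_one to_fract_1)

lemma module_S: "module base_field S"
  by (intro moduleI cring_base S.abelian_group_axioms)
    (auto simp: carrier_S smult_S to_fract_const_simps to_fract_const_1 smult_l_distr smult_r_distr smult_assoc smult_one
      simp flip: proj.hom_add)

lemma assoc_algebra_S: "assoc_algebra base_field S"
  unfolding assoc_algebra_def
  by (intro conjI ring_S module_S)
    (auto simp: carrier_S smult_S smult_mult_left smult_mult_right simp flip: proj.hom_mult)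

lemma algebra_S: "cring S \<Longrightarrow> algebra base_field S"
  using assoc_algebra_S module_S unfolding assoc_algebra_def
  by (intro algebra.intro algebra_axioms.intro) auto

lemma generate_S:
  assumes "H \<subseteq> carrier B" "generate_ring B H = carrier B"
  shows "generate_ring S (\<gamma> ` H) = carrier S"
proof
  show "generate_ring S (\<gamma> ` H) \<subseteq> carrier S"
    using assms by (intro S.generate_ring_incl) auto
  have "\<gamma> x \<in> generate_ring S (\<gamma> ` H)" if "x \<in> generate_ring B H" for x
    using that
  proof induction
    case (eng_add x y)
    then show ?case using assms by (simp add: generate_ring.eng_add)
  next
    case (eng_mult x y)
    then show ?case using assms by (simp add: generate_ring.eng_mult)
  next
    case (a_inv x)
    then show ?case using assms by (simp add: generate_ring.a_inv)
  qed (auto intro: generate_ring.intros)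
  then show "carrier S \<subseteq> generate_ring S (\<gamma> ` H)" using assms by (auto simp: carrier_S)
qed

end


section \<open>Maps induced on specialisations\<close>

lemma linear_endo_closed: "linear_endo F B f \<Longrightarrow> x \<in> carrier B \<Longrightarrow> f x \<in> carrier B"
  by (auto simp: linear_endo_def)

text \<open>If \<open>y - x\<close> is \<open>t - \<mu>\<close> times \<open>z\<close>, then
  \<open>f y - f x\<close> is \<open>t - \<mu>\<close> times \<open>f z\<close>; hence the image of
  a coset is a single class. Source and target may differ, so that the rule covers \<iota> as well
  as the endomorphisms \<sigma> and \<delta>.\<close>

lemma spec_map_proj:
  assumes "specialisation F B" "specialisation F C"
    and f: "f \<in> carrier B \<rightarrow> carrier C"
    and add: "\<And>x y. x \<in> carrier B \<Longrightarrow> y \<in> carrier B \<Longrightarrow> f (x \<oplus>\<^bsub>B\<^esub> y) = f x \<oplus>\<^bsub>C\<^esub> f y"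
    and smult: "\<And>x. x \<in> carrier B \<Longrightarrow> f (t_minus \<mu> \<odot>\<^bsub>B\<^esub> x) = t_minus \<mu> \<odot>\<^bsub>C\<^esub> f x"
    and x: "x \<in> carrier B"
  shows "spec_map C \<mu> f (spec_proj B \<mu> x) = spec_proj C \<mu> (f x)"
proof -
  interpret B: specialisation F B \<mu> by fact
  interpret C: specialisation F C \<mu> by fact
  have "spec_proj C \<mu> (f y) = spec_proj C \<mu> (f x)" if "y \<in> spec_proj B \<mu> x" for y
  proof -
    have y: "y \<in> carrier B" "y \<ominus>\<^bsub>B\<^esub> x \<in> spec_ideal B \<mu>"
      using that x by (auto simp: B.mem_proj_iff B.proj_eq_iff)
    then obtain z where z: "z \<in> carrier B" "y \<ominus>\<^bsub>B\<^esub> x = t_minus \<mu> \<odot>\<^bsub>B\<^esub> z"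
      by (metis B.J_E B.h_mult)
    have fc: "f x \<in> carrier C" "f z \<in> carrier C" using f x z by auto
    have "y = (y \<ominus>\<^bsub>B\<^esub> x) \<oplus>\<^bsub>B\<^esub> x" using x y by (simp add: B.minus_eq B.a_assoc B.l_neg)
    then have "f y = t_minus \<mu> \<odot>\<^bsub>C\<^esub> f z \<oplus>\<^bsub>C\<^esub> f x"
      using x z add smult by (metis B.smult_closed B.t_minus_in)
    then have "f y \<ominus>\<^bsub>C\<^esub> f x = t_minus \<mu> \<odot>\<^bsub>C\<^esub> f z"
      using fc by (simp add: C.minus_eq C.a_assoc C.r_neg)
    then show ?thesis using f x y C.J_I[of "f z"] fc by (subst C.proj_eq_iff) (auto simp: C.h_mult)
  qed
  then have "(\<lambda>y. spec_proj C \<mu> (f y)) ` spec_proj B \<mu> x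
      = (\<lambda>y. spec_proj C \<mu> (f x)) ` spec_proj B \<mu> x"
    by (intro image_cong refl)
  also have "\<dots> = {spec_proj C \<mu> (f x)}"
    using x B.mem_proj_iff[OF x, of x] by (auto simp: image_constant_conv)
  finally show ?thesis by (simp add: spec_map_def)
qed

context specialisation
begin

lemma spec_map_endo_proj:
  assumes "linear_endo (fract_subring F) B f" "x \<in> carrier B"
  shows "spec_map B \<mu> f (\<gamma> x) = \<gamma> (f x)"
  using assms by (intro spec_map_proj[of F] specialisation_axioms) (auto simp: linear_endo_def)

text \<open>Meant for \<open>\<sigma> 1 1\<close> and \<open>\<sigma> 2 2\<close>, whose difference
  from the identity is divided by \<open>t - 1\<close> in \<alpha>11 and \<alpha>22.\<close>

lemma linear_endo_minus_id:
  assumes f: "linear_endo (fract_subring F) B f"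
  shows "linear_endo (fract_subring F) B (\<lambda>a. f a \<ominus> a)"
  using f linear_endo_closed[OF f] unfolding linear_endo_def
  by (auto simp: smult_minus) (simp add: minus_eq minus_add a_ac)

lemma linear_endo_spec_map:
  assumes "linear_endo (fract_subring F) B f"
  shows "linear_endo base_field S (spec_map B \<mu> f)"
  using assms unfolding linear_endo_def
  by (auto simp: carrier_S smult_S spec_map_endo_proj[OF assms] Pi_iff simp flip: proj.hom_add)

end


section \<open>The Poisson bracket of a semiclassical limit\<close>

locale semiclassical = specialisation +
  assumes regular: "nonzero_nonunit_regular B h" and comm: "cring S"
begin

lemma h_cancel:
  assumes "x \<in> carrier B" "y \<in> carrier B" "h \<otimes> x = h \<otimes> y"
  shows "x = y"
proof -
  have "h \<otimes> (x \<ominus> y) = \<zero>" using assms by (simp add: minus_eq r_distr r_minus r_neg)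
  then have "x \<ominus> y = \<zero>"
    using regular assms minus_closed unfolding nonzero_nonunit_regular_def by blast
  then show ?thesis using assms(1,2) by simp
qed

lemma div_by_eqI: "y \<in> carrier B \<Longrightarrow> h \<otimes> y = x \<Longrightarrow> div_by B h x = y"
  unfolding div_by_def by (rule the_equality) (auto intro: h_cancel)

lemma div_by_closed [simp]: "x \<in> J \<Longrightarrow> div_by B h x \<in> carrier B"
  and h_div_by: "x \<in> J \<Longrightarrow> h \<otimes> div_by B h x = x"
  by (auto elim!: J_E simp: div_by_eqI[OF _ refl])

text \<open>Quotients by the regular element \<open>h\<close> are unique, so linearity can be
  checked after multiplication by \<open>h\<close>. This is what lets the maps \<alpha> and \<nu>
  descend to the quotient.\<close>

lemma linear_endo_div_by:
  assumes f: "linear_endo (fract_subring F) B f" and J: "\<And>x. x \<in> carrier B \<Longrightarrow> f x \<in> J"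
  shows "linear_endo (fract_subring F) B (\<lambda>x. div_by B h (f x))"
proof -
  have "div_by B h (f (c \<odot> x)) = c \<odot> div_by B h (f x)" if "c \<in> F" "x \<in> carrier B" for c x
    using that f J by (intro div_by_eqI)
      (auto simp: linear_endo_def h_div_by smult_mult_right)
  moreover have "div_by B h (f (x \<oplus> y)) = div_by B h (f x) \<oplus> div_by B h (f y)"
    if "x \<in> carrier B" "y \<in> carrier B" for x y
    using that f J by (intro div_by_eqI) (auto simp: linear_endo_def h_div_by r_distr)
  ultimately show ?thesis using J by (auto simp: linear_endo_def)
qed

text \<open>A lift of the bracket from cosets to \<open>B\<close>. The Poisson identities already
  hold exactly for this lift, so they are proved for elements and projected afterwards.\<close>

definition d where "d x y = div_by B h (x \<otimes> y \<ominus> y \<otimes> x)"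

text \<open>The quotient is commutative, so commutators project to zero; the division by
  \<open>h\<close> in \<open>d\<close> is therefore exact.\<close>

lemma commutator_in_J: "x \<in> carrier B \<Longrightarrow> y \<in> carrier B \<Longrightarrow> x \<otimes> y \<ominus> y \<otimes> x \<in> J"
  using cring.cring_simprules(14)[OF comm, of "\<gamma> x" "\<gamma> y"] by (simp flip: proj_eq_iff)

lemma d_closed [simp]: "x \<in> carrier B \<Longrightarrow> y \<in> carrier B \<Longrightarrow> d x y \<in> carrier B"
  and h_d: "x \<in> carrier B \<Longrightarrow> y \<in> carrier B \<Longrightarrow> h \<otimes> d x y = x \<otimes> y \<ominus> y \<otimes> x"
  by (simp_all add: d_def h_div_by commutator_in_J)

lemma d_eqI: "z \<in> carrier B \<Longrightarrow> h \<otimes> z = x \<otimes> y \<ominus> y \<otimes> x \<Longrightarrow> d x y = z"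
  unfolding d_def by (rule div_by_eqI)

lemma h_lcomm: "x \<in> carrier B \<Longrightarrow> y \<in> carrier B \<Longrightarrow> x \<otimes> (h \<otimes> y) = h \<otimes> (x \<otimes> y)"
  using h_central[of x] by (simp flip: m_assoc)

lemma d_add_left:
  assumes "x \<in> carrier B" "y \<in> carrier B" "z \<in> carrier B"
  shows "d (x \<oplus> y) z = d x z \<oplus> d y z"
  using assms by (intro d_eqI) (simp_all add: r_distr l_distr h_d minus_eq minus_add a_ac)

lemma d_add_right:
  assumes "x \<in> carrier B" "y \<in> carrier B" "z \<in> carrier B"
  shows "d z (x \<oplus> y) = d z x \<oplus> d z y"
  using assms by (intro d_eqI) (simp_all add: r_distr l_distr h_d minus_eq minus_add a_ac)

lemma d_smult:
  assumes "c \<in> F" "x \<in> carrier B" "y \<in> carrier B"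
  shows "d (c \<odot> x) y = c \<odot> d x y" "d x (c \<odot> y) = c \<odot> d x y"
  using assms
  by (auto intro!: d_eqI simp: smult_mult_left smult_mult_right h_d smult_minus)

lemma d_self: "x \<in> carrier B \<Longrightarrow> d x x = \<zero>"
  by (intro d_eqI) (simp_all add: minus_eq r_neg)

text \<open>The commutator with \<open>x\<close> is a derivation, and the central \<open>h\<close>
  can be moved past \<open>y\<close>. The order of the factors matters, since \<open>B\<close> need
  not be commutative.\<close>

lemma d_leibniz:
  assumes "x \<in> carrier B" "y \<in> carrier B" "z \<in> carrier B"
  shows "d x (y \<otimes> z) = d x y \<otimes> z \<oplus> y \<otimes> d x z"
proof (rule d_eqI)
  have "h \<otimes> (d x y \<otimes> z \<oplus> y \<otimes> d x z) = (h \<otimes> d x y) \<otimes> z \<oplus> y \<otimes> (h \<otimes> d x z)"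
    using assms by (simp add: r_distr m_assoc h_lcomm)
  also have "\<dots> = x \<otimes> (y \<otimes> z) \<ominus> (y \<otimes> z) \<otimes> x"
    using assms by (simp add: h_d ring_simprules)
  finally show "h \<otimes> (d x y \<otimes> z \<oplus> y \<otimes> d x z) = x \<otimes> (y \<otimes> z) \<ominus> (y \<otimes> z) \<otimes> x" .
qed (use assms in simp)

text \<open>Each nesting of \<open>d\<close> costs one factor \<open>h\<close>, so two factors turn
  it into the double commutator.\<close>

lemma h_h_d_d:
  assumes "x \<in> carrier B" "y \<in> carrier B" "z \<in> carrier B"
  shows "h \<otimes> (h \<otimes> d x (d y z)) = x \<otimes> (y \<otimes> z \<ominus> z \<otimes> y) \<ominus> (y \<otimes> z \<ominus> z \<otimes> y) \<otimes> x"
proof -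
  have "h \<otimes> (h \<otimes> d x (d y z)) = x \<otimes> (h \<otimes> d y z) \<ominus> (h \<otimes> d y z) \<otimes> x"
    using assms by (simp add: h_d[of x] h_lcomm minus_eq r_distr r_minus m_assoc)
  then show ?thesis using assms by (simp add: h_d)
qed

lemma d_jacobi:
  assumes "x \<in> carrier B" "y \<in> carrier B" "z \<in> carrier B"
  shows "d x (d y z) \<oplus> d y (d z x) \<oplus> d z (d x y) = \<zero>" (is "?j = _")
proof -
  \<comment> \<open>In the cyclic sum of the double commutators each of the six products of
    \<open>x\<close>, \<open>y\<close>, \<open>z\<close> occurs once with a plus and once with a
    minus sign; \<open>?s\<close> is their sum.\<close>
  let ?s = "x \<otimes> (y \<otimes> z) \<oplus> x \<otimes> (z \<otimes> y) \<oplus> y \<otimes> (x \<otimes> z) \<oplus> y \<otimes> (z \<otimes> x)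
    \<oplus> z \<otimes> (x \<otimes> y) \<oplus> z \<otimes> (y \<otimes> x)"
  have "h \<otimes> (h \<otimes> ?j) = h \<otimes> (h \<otimes> d x (d y z)) \<oplus> h \<otimes> (h \<otimes> d y (d z x)) \<oplus> h \<otimes> (h \<otimes> d z (d x y))"
    using assms by (simp add: r_distr)
  also have "\<dots> = ?s \<ominus> ?s"
    using assms by (simp add: h_h_d_d minus_eq minus_add l_distr r_distr l_minus r_minus m_assoc a_ac)
  also have "\<dots> = h \<otimes> (h \<otimes> \<zero>)" using assms by (simp add: minus_eq r_neg)
  finally have "h \<otimes> ?j = h \<otimes> \<zero>" by (rule h_cancel[rotated 2]) (use assms in simp_all)
  then show ?thesis by (rule h_cancel[rotated 2]) (use assms in simp_all)
qed

abbreviation "bracket \<equiv> semiclassical_bracket B h"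

text \<open>Well-definedness of the bracket: changing an argument by a multiple of \<open>h\<close>
  changes \<open>d\<close> by a multiple of \<open>h\<close>, by bilinearity, and this projects to
  zero.\<close>

lemma bracket_proj:
  assumes x: "x \<in> carrier B" and y: "y \<in> carrier B"
  shows "bracket (\<gamma> x) (\<gamma> y) = \<gamma> (d x y)"
proof -
  have "\<gamma> (d a b) = \<gamma> (d x y)" if "a \<in> \<gamma> x" "b \<in> \<gamma> y" for a b
  proof -
    have ab: "a \<in> carrier B" "a \<ominus> x \<in> J" "b \<in> carrier B" "b \<ominus> y \<in> J"
      using that x y by (auto simp: mem_proj_iff proj_eq_iff)
    then obtain u v where u: "u \<in> carrier B" "a \<ominus> x = t_minus \<mu> \<odot> u"
      and v: "v \<in> carrier B" "b \<ominus> y = t_minus \<mu> \<odot> v"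
      by (metis J_E h_mult)
    have "a = (a \<ominus> x) \<oplus> x" "b = (b \<ominus> y) \<oplus> y"
      using x y ab by (simp_all add: minus_eq a_assoc l_neg)
    then have eq: "a = t_minus \<mu> \<odot> u \<oplus> x" "b = t_minus \<mu> \<odot> v \<oplus> y"
      using u v by simp_all
    have "d a b = d (t_minus \<mu> \<odot> u \<oplus> x) b" using eq(1) by simp
    also have "\<dots> = t_minus \<mu> \<odot> d u b \<oplus> d x b"
      using x u ab by (simp add: d_add_left d_smult)
    also have "d x b = d x (t_minus \<mu> \<odot> v \<oplus> y)" using eq(2) by simp
    also have "\<dots> = t_minus \<mu> \<odot> d x v \<oplus> d x y"
      using x y v by (simp add: d_add_right d_smult)
    finally have "d a b = h \<otimes> d u b \<oplus> (h \<otimes> d x v \<oplus> d x y)"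
      using x u v ab by (simp add: h_mult)
    moreover have "\<gamma> h = \<zero>\<^bsub>S\<^esub>"
      using proj_eq_iff[of h \<zero>] J_I[of \<one>] by (simp add: minus_eq)
    ultimately show ?thesis using x y u v ab by simp
  qed
  \<comment> \<open>The set under \<open>the_elem\<close> has exactly one element; it is inhabited
    because \<open>x\<close> and \<open>y\<close> lie in their own cosets.\<close>
  then have "{J +> div_by B h (a \<otimes> b \<ominus> b \<otimes> a) |a b. a \<in> \<gamma> x \<and> b \<in> \<gamma> y} = {\<gamma> (d x y)}"
    using mem_proj_iff[OF x, of x] mem_proj_iff[OF y, of y] x y
    unfolding d_def[symmetric] spec_proj_def[symmetric] by blast
  then show ?thesis
    unfolding semiclassical_bracket_def spec_ideal_def[symmetric] by simp
qed

lemma poisson_algebra_S: "poisson_algebra base_field S bracket"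
proof -
  have *: "\<gamma> \<zero> = \<zero>\<^bsub>S\<^esub>" by simp
  show ?thesis
    unfolding poisson_algebra_def carrier_S
    by (intro conjI algebra_S comm)
      (simp_all add: smult_S bracket_proj d_add_left d_add_right d_smult d_self d_leibniz d_jacobi *
        flip: proj.hom_add proj.hom_mult)
qed

lemma has_semiclassical_limit: "has_semiclassical_limit B h"
  using regular comm
  by (simp add: has_semiclassical_limit_def h_central cring_S_iff flip: spec_ideal_def)

end

text \<open>An embedding of \<open>R\<close> in \<open>A\<close> need not stay injective modulo
  \<open>t - \<mu>\<close>; here injectivity comes from the freeness of the quotient, by comparing
  coefficients of the monomial with exponents \<open>(0, 0)\<close>.\<close>

lemma free_on_monomials_imp_inj:
  assumes "ring R" "ring A" and \<iota>: "\<iota> \<in> ring_hom R A" and y: "y1 \<in> carrier A" "y2 \<in> carrier A"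
    and free: "free_on_monomials R A \<iota> y1 y2"
  shows "inj_on \<iota> (carrier R)"
proof (rule inj_onI)
  interpret R: ring R by fact
  interpret A: ring A by fact
  interpret \<iota>: ring_hom_ring R A \<iota> by (intro ring_hom_ringI2 assms)
  let ?c = "\<lambda>x (p :: nat \<times> nat). if p = (0, 0) then x else \<zero>\<^bsub>R\<^esub>"
  let ?rep = "\<lambda>a (c :: nat \<times> nat \<Rightarrow> _). range c \<subseteq> carrier R \<and> finite {p. c p \<noteq> \<zero>\<^bsub>R\<^esub>} \<and>
    a = (\<Oplus>\<^bsub>A\<^esub>p\<in>{p. c p \<noteq> \<zero>\<^bsub>R\<^esub>}. \<iota> (c p) \<otimes>\<^bsub>A\<^esub> (y1 [^]\<^bsub>A\<^esub> fst p \<otimes>\<^bsub>A\<^esub> y2 [^]\<^bsub>A\<^esub> snd p))"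
  have rep: "?rep (\<iota> x) (?c x)" if "x \<in> carrier R" for x
  \<comment> \<open>The support is empty for \<open>x = 0\<close>, and it is the single pair
    \<open>(0, 0)\<close> otherwise.\<close>
  proof (cases "x = \<zero>\<^bsub>R\<^esub>")
    case False
    then have "{p. ?c x p \<noteq> \<zero>\<^bsub>R\<^esub>} = {(0, 0)}" by auto
    then show ?thesis using that by (auto simp: A.finsum_insert)
  qed auto
  fix x x' assume x: "x \<in> carrier R" "x' \<in> carrier R" "\<iota> x = \<iota> x'"
  define P where "P c \<longleftrightarrow> ?rep (\<iota> x) c" for c
  have "\<exists>!c. P c"
    unfolding P_def using x(1) by (intro bspec[OF free[unfolded free_on_monomials_def]] \<iota>.hom_closed)
  moreover have "P (?c x)" "P (?c x')" unfolding P_def using rep[OF x(1)] rep[OF x(2)] x(3) by simp_all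
  ultimately have "?c x = ?c x'" by blast
  from fun_cong[OF this, of "(0, 0)"] show "x = x'" by simp
qed

text \<open>The centraliser of a fixed element is a subring, so it is the whole ring once it
  contains the generators.\<close>

lemma (in ring) cring_if_generators_commute:
  assumes H: "H \<subseteq> carrier R" "generate_ring R H = carrier R"
    and comm: "\<And>x y. x \<in> H \<Longrightarrow> y \<in> H \<Longrightarrow> x \<otimes> y = y \<otimes> x"
  shows "cring R"
proof -
  have step: "x \<otimes> y = y \<otimes> x"
    if "x \<in> generate_ring R H" "y \<in> carrier R" "\<And>z. z \<in> H \<Longrightarrow> z \<otimes> y = y \<otimes> z" for x y
    using that(1)
  proof induction
    case (eng_mult a b)
    then have ab: "a \<in> carrier R" "b \<in> carrier R" using H by auto
    have "a \<otimes> b \<otimes> y = a \<otimes> (y \<otimes> b)" using ab that(2) eng_mult.IH(2) by (simp add: m_assoc)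
    also have "\<dots> = y \<otimes> a \<otimes> b"
      using ab that(2) by (simp add: eng_mult.IH(1) flip: m_assoc)
    finally show ?case using ab that(2) by (simp add: m_assoc)
  qed (use that H in \<open>auto simp: l_minus r_minus l_distr r_distr\<close>)
  \<comment> \<open>\<open>step\<close> is applied twice: with a generator as the fixed element,
    every element commutes with the generators; this is then the premise for an arbitrary fixed
    element.\<close>
  have "x \<otimes> y = y \<otimes> x" if "x \<in> carrier R" "y \<in> carrier R" for x y
    using that H comm step by (metis subsetD)
  then show ?thesis by (simp add: cring_iff_ring_commute ring_axioms)
qed



section \<open>Specialisation of double extensions\<close>

text \<open>Keeps the indices \<open>1\<close> of \<open>\<sigma>\<close>, \<open>\<delta>\<close> and \<open>\<tau>\<close> from being rewritten to \<open>Suc 0\<close>.\<close>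

declare One_nat_def [simp del]

text \<open>The setting at one point \<mu>, for the points of \<Lambda> and for \<mu> = 1 alike.
  \<open>M\<close> stands for \<open>insert 1 \<Lambda>\<close>, at whose points elements of
  \<open>F\<close> can be evaluated.\<close>

locale double_extension_at = R: specialisation F R \<mu> + A: specialisation F A \<mu>
  for F :: "'k::field_char_0 poly fract set"
    and R :: "('k poly fract, 'r, 'm) module_scheme"
    and A :: "('k poly fract, 'a, 'n) module_scheme"
    and \<mu> :: 'k +
  fixes \<iota> :: "'r \<Rightarrow> 'a" and y1 y2 :: 'a and p11 p12 :: "'k poly fract"
    and \<sigma> :: "nat \<Rightarrow> nat \<Rightarrow> 'r \<Rightarrow> 'r" and \<delta> :: "nat \<Rightarrow> 'r \<Rightarrow> 'r" and \<tau> :: "nat \<Rightarrow> 'r"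
    and M :: "'k set"
  assumes regular_F: "F \<subseteq> regular_at M" and \<mu>: "\<mu> \<in> M"
    and data: "right_double_extension_data (fract_subring F) R A \<iota> y1 y2 p11 p12 \<sigma> \<delta> \<tau>"
    and free: "free_on_monomials (spec_algebra R \<mu>) (spec_algebra A \<mu>) (spec_map A \<mu> \<iota>)
      (spec_proj A \<mu> y1) (spec_proj A \<mu> y2)"
begin

abbreviation "\<iota>' \<equiv> spec_map A \<mu> \<iota>"
abbreviation "Y1 \<equiv> A.\<gamma> y1"
abbreviation "Y2 \<equiv> A.\<gamma> y2"

lemma extension: "right_double_extension (fract_subring F) R A \<iota> y1 y2"
  using data by (simp add: right_double_extension_data_def)

lemma y_closed [simp]: "y1 \<in> carrier A" "y2 \<in> carrier A"
  using extension by (simp_all add: right_double_extension_def)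

lemma embedding: "algebra_embedding (fract_subring F) R A \<iota>"
  using extension by (simp add: right_double_extension_def)

sublocale \<iota>: ring_hom_ring R A \<iota>
  using embedding by (intro ring_hom_ringI2 R.ring_axioms A.ring_axioms) (simp add: algebra_embedding_def)

lemma \<iota>_inj: "inj_on \<iota> (carrier R)"
  using embedding by (simp add: algebra_embedding_def)

lemma \<iota>_smult: "c \<in> F \<Longrightarrow> x \<in> carrier R \<Longrightarrow> \<iota> (c \<odot>\<^bsub>R\<^esub> x) = c \<odot>\<^bsub>A\<^esub> \<iota> x"
  using embedding by (simp add: algebra_embedding_def)

lemma generate: "generate_ring A (\<iota> ` carrier R \<union> {y1, y2}) = carrier A"
  using extension by (simp add: right_double_extension_def)

lemma p_in: "p11 \<in> F" "p12 \<in> F" and \<tau>_in: "\<tau> \<in> {0, 1, 2} \<rightarrow> carrier R"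
  using data by (simp_all add: right_double_extension_data_def)

lemma \<tau>_closed [simp]: "\<tau> 0 \<in> carrier R" "\<tau> 1 \<in> carrier R" "\<tau> 2 \<in> carrier R"
  using \<tau>_in by auto

lemma relation: "y2 \<otimes>\<^bsub>A\<^esub> y1 =
    p11 \<odot>\<^bsub>A\<^esub> (y1 [^]\<^bsub>A\<^esub> (2::nat)) \<oplus>\<^bsub>A\<^esub> p12 \<odot>\<^bsub>A\<^esub> (y1 \<otimes>\<^bsub>A\<^esub> y2)
    \<oplus>\<^bsub>A\<^esub> \<iota> (\<tau> 1) \<otimes>\<^bsub>A\<^esub> y1 \<oplus>\<^bsub>A\<^esub> \<iota> (\<tau> 2) \<otimes>\<^bsub>A\<^esub> y2 \<oplus>\<^bsub>A\<^esub> \<iota> (\<tau> 0)"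
  using data unfolding right_double_extension_data_def DE_relation_def by blast

lemma \<sigma>_linear: "i \<in> {1, 2} \<Longrightarrow> j \<in> {1, 2} \<Longrightarrow> linear_endo (fract_subring F) R (\<sigma> i j)"
  and \<delta>_linear: "i \<in> {1, 2} \<Longrightarrow> linear_endo (fract_subring F) R (\<delta> i)"
  using data unfolding right_double_extension_data_def by blast+

lemma \<sigma>_closed [simp]: "i \<in> {1, 2} \<Longrightarrow> j \<in> {1, 2} \<Longrightarrow> a \<in> carrier R \<Longrightarrow> \<sigma> i j a \<in> carrier R"
  and \<delta>_closed [simp]: "i \<in> {1, 2} \<Longrightarrow> a \<in> carrier R \<Longrightarrow> \<delta> i a \<in> carrier R"
  by (rule linear_endo_closed[OF \<sigma>_linear] linear_endo_closed[OF \<delta>_linear], assumption+)+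

lemma y_mult:
  assumes "a \<in> carrier R"
  shows "y1 \<otimes>\<^bsub>A\<^esub> \<iota> a = \<iota> (\<sigma> 1 1 a) \<otimes>\<^bsub>A\<^esub> y1 \<oplus>\<^bsub>A\<^esub> \<iota> (\<sigma> 1 2 a) \<otimes>\<^bsub>A\<^esub> y2 \<oplus>\<^bsub>A\<^esub> \<iota> (\<delta> 1 a)"
    and "y2 \<otimes>\<^bsub>A\<^esub> \<iota> a = \<iota> (\<sigma> 2 1 a) \<otimes>\<^bsub>A\<^esub> y1 \<oplus>\<^bsub>A\<^esub> \<iota> (\<sigma> 2 2 a) \<otimes>\<^bsub>A\<^esub> y2 \<oplus>\<^bsub>A\<^esub> \<iota> (\<delta> 2 a)"
  using data assms unfolding right_double_extension_data_def by blast+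

lemma \<iota>'_proj: "x \<in> carrier R \<Longrightarrow> \<iota>' (R.\<gamma> x) = A.\<gamma> (\<iota> x)"
  by (intro spec_map_proj[of F] R.specialisation_axioms A.specialisation_axioms)
    (auto simp: \<iota>_smult)

lemma \<iota>'_hom: "\<iota>' \<in> ring_hom R.S A.S"
  by (intro ring_hom_memI)
    (auto simp: R.carrier_S A.carrier_S \<iota>'_proj
      simp flip: R.proj.hom_add A.proj.hom_add R.proj.hom_mult A.proj.hom_mult
        R.proj.hom_one A.proj.hom_one)

sublocale \<iota>': ring_hom_ring R.S A.S \<iota>'
  by (intro ring_hom_ringI2 R.ring_S A.ring_S \<iota>'_hom)

lemma embedding': "algebra_embedding base_field R.S A.S \<iota>'"
  unfolding algebra_embedding_def
proof (intro conjI \<iota>'_hom)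
  show "inj_on \<iota>' (carrier R.S)"
    by (rule free_on_monomials_imp_inj[OF R.ring_S A.ring_S \<iota>'_hom _ _ free]) auto
qed (auto simp: R.carrier_S \<iota>'_proj R.smult_S A.smult_S \<iota>_smult)

lemma generate': "generate_ring A.S (\<iota>' ` carrier R.S \<union> {Y1, Y2}) = carrier A.S"
proof -
  have "\<iota>' ` carrier R.S \<union> {Y1, Y2} = A.\<gamma> ` (\<iota> ` carrier R \<union> {y1, y2})"
    by (auto simp: R.carrier_S \<iota>'_proj image_image)
  moreover have "\<iota> ` carrier R \<union> {y1, y2} \<subseteq> carrier A" by auto
  ultimately show ?thesis using A.generate_S generate by (simp only:)
qed

lemma eval: "p \<in> F \<Longrightarrow> z \<in> carrier A \<Longrightarrow> fract_eval \<mu> p \<odot>\<^bsub>A.S\<^esub> A.\<gamma> z = A.\<gamma> (p \<odot>\<^bsub>A\<^esub> z)"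
  using A.proj_smult_eval[OF _ _ \<mu>] regular_F by auto

lemma proj_y1_square: "Y1 [^]\<^bsub>A.S\<^esub> (2::nat) = A.\<gamma> (y1 [^]\<^bsub>A\<^esub> (2::nat))"
  by (rule A.proj.hom_nat_pow[symmetric]) simp

lemma DE_relation':
  "DE_relation A.S \<iota>' Y1 Y2 (fract_eval \<mu> p11) (fract_eval \<mu> p12) (\<lambda>i. R.\<gamma> (\<tau> i))"
  unfolding DE_relation_def proj_y1_square using relation p_in
  by (simp add: eval \<iota>'_proj flip: A.proj.hom_add A.proj.hom_mult)

lemma y_mult':
  assumes "a \<in> carrier R.S"
  shows "Y1 \<otimes>\<^bsub>A.S\<^esub> \<iota>' a = \<iota>' (spec_map R \<mu> (\<sigma> 1 1) a) \<otimes>\<^bsub>A.S\<^esub> Y1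
      \<oplus>\<^bsub>A.S\<^esub> \<iota>' (spec_map R \<mu> (\<sigma> 1 2) a) \<otimes>\<^bsub>A.S\<^esub> Y2 \<oplus>\<^bsub>A.S\<^esub> \<iota>' (spec_map R \<mu> (\<delta> 1) a)" (is ?t1)
    and "Y2 \<otimes>\<^bsub>A.S\<^esub> \<iota>' a = \<iota>' (spec_map R \<mu> (\<sigma> 2 1) a) \<otimes>\<^bsub>A.S\<^esub> Y1
      \<oplus>\<^bsub>A.S\<^esub> \<iota>' (spec_map R \<mu> (\<sigma> 2 2) a) \<otimes>\<^bsub>A.S\<^esub> Y2 \<oplus>\<^bsub>A.S\<^esub> \<iota>' (spec_map R \<mu> (\<delta> 2) a)" (is ?t2)
proof -
  obtain x where x: "x \<in> carrier R" "a = R.\<gamma> x" using assms by (auto simp: R.carrier_S)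
  note spec = R.spec_map_endo_proj[OF \<sigma>_linear x(1)] R.spec_map_endo_proj[OF \<delta>_linear x(1)]
  show ?t1 ?t2
    using x y_mult[OF x(1)] by (simp_all add: spec \<iota>'_proj flip: A.proj.hom_add A.proj.hom_mult)
qed

lemma right_double_extension_data':
  "right_double_extension_data base_field R.S A.S \<iota>' Y1 Y2 (fract_eval \<mu> p11) (fract_eval \<mu> p12)
    (\<lambda>i j. spec_map R \<mu> (\<sigma> i j)) (\<lambda>i. spec_map R \<mu> (\<delta> i)) (\<lambda>i. R.\<gamma> (\<tau> i))"
proof -
  have lin: "linear_endo base_field R.S (spec_map R \<mu> (\<sigma> i j))" if "i \<in> {1, 2}" "j \<in> {1, 2}" for i j
    using that by (intro R.linear_endo_spec_map \<sigma>_linear)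
  have lin': "linear_endo base_field R.S (spec_map R \<mu> (\<delta> i))" if "i \<in> {1, 2}" for i
    using that by (intro R.linear_endo_spec_map \<delta>_linear)
  have cl: "spec_map R \<mu> (\<sigma> i j) a \<in> carrier R.S"
    if "i \<in> {1, 2}" "j \<in> {1, 2}" "a \<in> carrier R.S" for i j a
    by (rule linear_endo_closed[OF lin[OF that(1,2)] that(3)])
  have cl': "spec_map R \<mu> (\<delta> i) a \<in> carrier R.S" if "i \<in> {1, 2}" "a \<in> carrier R.S" for i a
    by (rule linear_endo_closed[OF lin'[OF that(1)] that(2)])
  have \<tau>': "(\<lambda>i. R.\<gamma> (\<tau> i)) \<in> {0, 1, 2} \<rightarrow> carrier R.S" by auto
  have ex: "\<exists>a'\<in>carrier R.S. \<exists>b'\<in>carrier R.S. \<exists>c'\<in>carrier R.S.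
      Y1 \<otimes>\<^bsub>A.S\<^esub> \<iota>' a \<oplus>\<^bsub>A.S\<^esub> Y2 \<otimes>\<^bsub>A.S\<^esub> \<iota>' b \<oplus>\<^bsub>A.S\<^esub> \<iota>' c =
      \<iota>' a' \<otimes>\<^bsub>A.S\<^esub> Y1 \<oplus>\<^bsub>A.S\<^esub> \<iota>' b' \<otimes>\<^bsub>A.S\<^esub> Y2 \<oplus>\<^bsub>A.S\<^esub> \<iota>' c'"
    if abc: "a \<in> carrier R.S" "b \<in> carrier R.S" "c \<in> carrier R.S" for a b c
    \<comment> \<open>The witnesses are the coefficients of \<open>Y1\<close>, \<open>Y2\<close> and
      1 collected after moving \<open>a\<close> past \<open>Y1\<close> and \<open>b\<close> past
      \<open>Y2\<close> by the commutation rules.\<close>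
    by (rule bexI[of _ "spec_map R \<mu> (\<sigma> 1 1) a \<oplus>\<^bsub>R.S\<^esub> spec_map R \<mu> (\<sigma> 2 1) b"],
        rule bexI[of _ "spec_map R \<mu> (\<sigma> 1 2) a \<oplus>\<^bsub>R.S\<^esub> spec_map R \<mu> (\<sigma> 2 2) b"],
        rule bexI[of _ "spec_map R \<mu> (\<delta> 1) a \<oplus>\<^bsub>R.S\<^esub> spec_map R \<mu> (\<delta> 2) b \<oplus>\<^bsub>R.S\<^esub> c"])
      (use abc cl cl' in \<open>simp_all add: y_mult' A.S.l_distr A.S.a_ac\<close>)
  have incl: "{Y1 \<otimes>\<^bsub>A.S\<^esub> \<iota>' a \<oplus>\<^bsub>A.S\<^esub> Y2 \<otimes>\<^bsub>A.S\<^esub> \<iota>' b \<oplus>\<^bsub>A.S\<^esub> \<iota>' c | a b c.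
        a \<in> carrier R.S \<and> b \<in> carrier R.S \<and> c \<in> carrier R.S}
     \<subseteq> {\<iota>' a \<otimes>\<^bsub>A.S\<^esub> Y1 \<oplus>\<^bsub>A.S\<^esub> \<iota>' b \<otimes>\<^bsub>A.S\<^esub> Y2 \<oplus>\<^bsub>A.S\<^esub> \<iota>' c | a b c.
        a \<in> carrier R.S \<and> b \<in> carrier R.S \<and> c \<in> carrier R.S}"
  proof (intro subsetI, elim CollectE exE conjE)
    fix u a b c
    assume u: "u = Y1 \<otimes>\<^bsub>A.S\<^esub> \<iota>' a \<oplus>\<^bsub>A.S\<^esub> Y2 \<otimes>\<^bsub>A.S\<^esub> \<iota>' b \<oplus>\<^bsub>A.S\<^esub> \<iota>' c"
      and "a \<in> carrier R.S" "b \<in> carrier R.S" "c \<in> carrier R.S"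
    from ex[OF this(2-)] obtain a' b' c' where
      "a' \<in> carrier R.S" "b' \<in> carrier R.S" "c' \<in> carrier R.S"
      "u = \<iota>' a' \<otimes>\<^bsub>A.S\<^esub> Y1 \<oplus>\<^bsub>A.S\<^esub> \<iota>' b' \<otimes>\<^bsub>A.S\<^esub> Y2 \<oplus>\<^bsub>A.S\<^esub> \<iota>' c'"
      unfolding u[symmetric] by (elim bexE)
    then show "u \<in> {\<iota>' a \<otimes>\<^bsub>A.S\<^esub> Y1 \<oplus>\<^bsub>A.S\<^esub> \<iota>' b \<otimes>\<^bsub>A.S\<^esub> Y2 \<oplus>\<^bsub>A.S\<^esub> \<iota>' c | a b c.
        a \<in> carrier R.S \<and> b \<in> carrier R.S \<and> c \<in> carrier R.S}"
      by (intro CollectI exI conjI)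
  qed
  have DE: "\<exists>p11\<in>carrier base_field. \<exists>p12\<in>carrier base_field. \<exists>\<tau>\<in>{0, 1, 2} \<rightarrow> carrier R.S.
      DE_relation A.S \<iota>' Y1 Y2 p11 p12 \<tau>"
    by (rule bexI, rule bexI, rule bexI[OF _ \<tau>'], rule DE_relation') simp_all
  have "right_double_extension base_field R.S A.S \<iota>' Y1 Y2"
    unfolding right_double_extension_def
    by (intro conjI R.assoc_algebra_S A.assoc_algebra_S embedding' generate' DE free incl
        A.proj_closed y_closed)
  then show ?thesis
    unfolding right_double_extension_data_def
    by (intro conjI ballI \<tau>' DE_relation' lin lin' y_mult') simp_all
qed

end

section \<open>The semiclassical limit of a double extension at \<mu> = 1\<close>

locale semiclassical_double_extension =
  double_extension_at F R A 1 \<iota> y1 y2 p11 p12 \<sigma> \<delta> \<tau> M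
  for F :: "'k::field_char_0 poly fract set"
    and R :: "('k poly fract, 'r, 'm) module_scheme"
    and A :: "('k poly fract, 'a, 'n) module_scheme"
    and \<iota> y1 y2 p11 p12 \<sigma> \<delta> \<tau> M +
  assumes p_near: "p11 \<in> (\<lambda>x. t_minus 1 * x) ` F" "p12 - 1 \<in> (\<lambda>x. t_minus 1 * x) ` F"
    and \<tau>_near: "i \<in> {0, 1, 2} \<Longrightarrow> \<tau> i \<in> R.J"
    and \<sigma>_near: "a \<in> carrier R \<Longrightarrow> \<sigma> 1 1 a \<ominus>\<^bsub>R\<^esub> a \<in> R.J" "a \<in> carrier R \<Longrightarrow> \<sigma> 1 2 a \<in> R.J"
      "a \<in> carrier R \<Longrightarrow> \<sigma> 2 1 a \<in> R.J" "a \<in> carrier R \<Longrightarrow> \<sigma> 2 2 a \<ominus>\<^bsub>R\<^esub> a \<in> R.J"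
    and \<delta>_near: "a \<in> carrier R \<Longrightarrow> \<delta> 1 a \<in> R.J" "a \<in> carrier R \<Longrightarrow> \<delta> 2 a \<in> R.J"
    and regular_A: "nonzero_nonunit_regular A A.h" and cring_R: "cring R.S"
begin

lemma \<iota>_h: "\<iota> R.h = A.h"
  by (simp add: t_minus_in_def \<iota>_smult)

text \<open>The standing assumption places this condition on \<open>A\<close>. It descends to
  \<open>R\<close> because \<iota> is injective and sends \<open>t - 1\<close> to
  \<open>t - 1\<close>: zero products are reflected, and an inverse in \<open>R\<close> would map to
  one in \<open>A\<close>.\<close>

lemma regular_R: "nonzero_nonunit_regular R R.h"
proof -
  have 0: "x = \<zero>\<^bsub>R\<^esub>" if "\<iota> x = \<zero>\<^bsub>A\<^esub>" "x \<in> carrier R" for x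
    using that \<iota>_inj by (metis R.zero_closed \<iota>.hom_zero inj_onD)
  have "R.h \<noteq> \<zero>\<^bsub>R\<^esub>"
    using regular_A \<iota>_h \<iota>.hom_zero unfolding nonzero_nonunit_regular_def by metis
  moreover have "A.h \<in> Units A" if "R.h \<in> Units R"
  proof -
    obtain y where y: "y \<in> carrier R" "y \<otimes>\<^bsub>R\<^esub> R.h = \<one>\<^bsub>R\<^esub>" "R.h \<otimes>\<^bsub>R\<^esub> y = \<one>\<^bsub>R\<^esub>"
      using \<open>R.h \<in> Units R\<close> unfolding Units_def by blast
    have "\<iota> y \<otimes>\<^bsub>A\<^esub> A.h = \<iota> (y \<otimes>\<^bsub>R\<^esub> R.h)" "A.h \<otimes>\<^bsub>A\<^esub> \<iota> y = \<iota> (R.h \<otimes>\<^bsub>R\<^esub> y)"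
      using y(1) by (simp_all add: \<iota>_h)
    then have "\<iota> y \<otimes>\<^bsub>A\<^esub> A.h = \<one>\<^bsub>A\<^esub>" "A.h \<otimes>\<^bsub>A\<^esub> \<iota> y = \<one>\<^bsub>A\<^esub>"
      by (simp_all only: y \<iota>.hom_one)
    then show ?thesis
      unfolding Units_def using A.h_closed \<iota>.hom_closed[OF y(1)] by (intro CollectI conjI bexI)
  qed
  moreover have "x = \<zero>\<^bsub>R\<^esub>"
    if "x \<in> carrier R" "R.h \<otimes>\<^bsub>R\<^esub> x = \<zero>\<^bsub>R\<^esub> \<or> x \<otimes>\<^bsub>R\<^esub> R.h = \<zero>\<^bsub>R\<^esub>" for x
  proof -
    have "A.h \<otimes>\<^bsub>A\<^esub> \<iota> x = \<iota> (R.h \<otimes>\<^bsub>R\<^esub> x)" "\<iota> x \<otimes>\<^bsub>A\<^esub> A.h = \<iota> (x \<otimes>\<^bsub>R\<^esub> R.h)"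
      using that(1) by (simp_all add: \<iota>_h)
    then have "A.h \<otimes>\<^bsub>A\<^esub> \<iota> x = \<zero>\<^bsub>A\<^esub> \<or> \<iota> x \<otimes>\<^bsub>A\<^esub> A.h = \<zero>\<^bsub>A\<^esub>"
      using that(2) by (metis \<iota>.hom_zero)
    then have "\<iota> x = \<zero>\<^bsub>A\<^esub>"
      using regular_A that(1) \<iota>.hom_closed unfolding nonzero_nonunit_regular_def by blast
    then show ?thesis using 0 that by blast
  qed
  moreover have "A.h \<notin> Units A" using regular_A by (simp add: nonzero_nonunit_regular_def)
  ultimately show ?thesis unfolding nonzero_nonunit_regular_def by (meson R.h_closed)
qed

sublocale R: semiclassical F R 1
  by (intro semiclassical.intro semiclassical_axioms.intro R.specialisation_axioms
      regular_R cring_R)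

lemma proj_J: "x \<in> A.J \<Longrightarrow> A.\<gamma> x = \<zero>\<^bsub>A.S\<^esub>"
  using A.proj_eq_iff[of x "\<zero>\<^bsub>A\<^esub>"] by (simp add: A.minus_eq)

lemma \<iota>_J: "x \<in> R.J \<Longrightarrow> \<iota> x \<in> A.J"
  by (elim R.J_E) (auto simp: \<iota>_h)

text \<open>At \<open>t = 1\<close> the coefficient \<open>p12\<close> becomes 1, while
  \<open>p11\<close> and all \<tau> become 0, so the quadratic relation reduces to
  commutativity.\<close>

lemma y1_y2_commute: "Y2 \<otimes>\<^bsub>A.S\<^esub> Y1 = Y1 \<otimes>\<^bsub>A.S\<^esub> Y2"
proof -
  obtain f g where f: "f \<in> F" "p11 = t_minus 1 * f" and g: "g \<in> F" "p12 - 1 = t_minus 1 * g"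
    using p_near by blast
  have "p12 = 1 + t_minus 1 * g" using g(2) by (simp add: algebra_simps)
  then have "p12 \<odot>\<^bsub>A\<^esub> (y1 \<otimes>\<^bsub>A\<^esub> y2) = (y1 \<otimes>\<^bsub>A\<^esub> y2) \<oplus>\<^bsub>A\<^esub> A.h \<otimes>\<^bsub>A\<^esub> (g \<odot>\<^bsub>A\<^esub> (y1 \<otimes>\<^bsub>A\<^esub> y2))"
    using R.to_fract_in[of 1] g by (simp add: A.smult_l_distr A.smult_assoc R.mult_in A.h_mult)
  then have 1: "A.\<gamma> (p12 \<odot>\<^bsub>A\<^esub> (y1 \<otimes>\<^bsub>A\<^esub> y2)) = Y1 \<otimes>\<^bsub>A.S\<^esub> Y2"
    using g by (simp add: proj_J A.J_I)
  have "p11 \<odot>\<^bsub>A\<^esub> (y1 [^]\<^bsub>A\<^esub> (2::nat)) = A.h \<otimes>\<^bsub>A\<^esub> (f \<odot>\<^bsub>A\<^esub> (y1 [^]\<^bsub>A\<^esub> (2::nat)))"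
    using f by (simp add: A.smult_assoc A.h_mult)
  then have 2: "A.\<gamma> (p11 \<odot>\<^bsub>A\<^esub> (y1 [^]\<^bsub>A\<^esub> (2::nat))) = \<zero>\<^bsub>A.S\<^esub>"
    using f by (simp add: proj_J A.J_I)
  have 3: "A.\<gamma> (\<iota> (\<tau> i)) = \<zero>\<^bsub>A.S\<^esub>" if "i \<in> {0, 1, 2}" for i
    using that by (intro proj_J \<iota>_J \<tau>_near)
  have "Y2 \<otimes>\<^bsub>A.S\<^esub> Y1 = A.\<gamma> (y2 \<otimes>\<^bsub>A\<^esub> y1)" by simp
  also have "\<dots> = Y1 \<otimes>\<^bsub>A.S\<^esub> Y2"
    unfolding relation using p_in by (simp add: 1 2 3 del: A.proj.hom_nat_pow)
  finally show ?thesis .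
qed

text \<open>Modulo \<open>t - 1\<close> the matrix \<sigma> is the identity and \<delta>
  vanishes.\<close>

lemma y_\<iota>_commute:
  assumes "a \<in> carrier R"
  shows "Y1 \<otimes>\<^bsub>A.S\<^esub> A.\<gamma> (\<iota> a) = A.\<gamma> (\<iota> a) \<otimes>\<^bsub>A.S\<^esub> Y1" "Y2 \<otimes>\<^bsub>A.S\<^esub> A.\<gamma> (\<iota> a) = A.\<gamma> (\<iota> a) \<otimes>\<^bsub>A.S\<^esub> Y2"
proof -
  have 1: "A.\<gamma> (\<iota> (\<sigma> 1 2 a)) = \<zero>\<^bsub>A.S\<^esub>" "A.\<gamma> (\<iota> (\<sigma> 2 1 a)) = \<zero>\<^bsub>A.S\<^esub>"
    "A.\<gamma> (\<iota> (\<delta> 1 a)) = \<zero>\<^bsub>A.S\<^esub>" "A.\<gamma> (\<iota> (\<delta> 2 a)) = \<zero>\<^bsub>A.S\<^esub>"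
    using assms by (auto intro!: proj_J \<iota>_J \<sigma>_near \<delta>_near)
  have "R.\<gamma> (\<sigma> 1 1 a) = R.\<gamma> a" "R.\<gamma> (\<sigma> 2 2 a) = R.\<gamma> a"
    using assms by (simp_all add: R.proj_eq_iff \<sigma>_near)
  then have 2: "A.\<gamma> (\<iota> (\<sigma> 1 1 a)) = A.\<gamma> (\<iota> a)" "A.\<gamma> (\<iota> (\<sigma> 2 2 a)) = A.\<gamma> (\<iota> a)"
    using assms by (simp_all flip: \<iota>'_proj)
  show "Y1 \<otimes>\<^bsub>A.S\<^esub> A.\<gamma> (\<iota> a) = A.\<gamma> (\<iota> a) \<otimes>\<^bsub>A.S\<^esub> Y1" "Y2 \<otimes>\<^bsub>A.S\<^esub> A.\<gamma> (\<iota> a) = A.\<gamma> (\<iota> a) \<otimes>\<^bsub>A.S\<^esub> Y2"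
    using arg_cong[OF y_mult(1)[OF assms], of A.\<gamma>] arg_cong[OF y_mult(2)[OF assms], of A.\<gamma>] assms
    by (simp_all add: 1 2)
qed

text \<open>Only \<open>R_1\<close> is assumed commutative; for \<open>A_1\<close> this follows from
  its generators, and it is what makes the bracket on \<open>A_1\<close> available.\<close>

lemma cring_A: "cring A.S"
proof (rule A.S.cring_if_generators_commute[OF _ generate'])
  show "\<iota>' ` carrier R.S \<union> {Y1, Y2} \<subseteq> carrier A.S" by auto
  fix x y assume "x \<in> \<iota>' ` carrier R.S \<union> {Y1, Y2}" "y \<in> \<iota>' ` carrier R.S \<union> {Y1, Y2}"
  moreover have "\<iota>' a \<otimes>\<^bsub>A.S\<^esub> \<iota>' b = \<iota>' b \<otimes>\<^bsub>A.S\<^esub> \<iota>' a" if "a \<in> carrier R.S" "b \<in> carrier R.S" for a b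
    using that cring_R by (simp add: cring_iff_ring_commute flip: \<iota>'.hom_mult)
  moreover have "Y1 \<otimes>\<^bsub>A.S\<^esub> \<iota>' a = \<iota>' a \<otimes>\<^bsub>A.S\<^esub> Y1" "Y2 \<otimes>\<^bsub>A.S\<^esub> \<iota>' a = \<iota>' a \<otimes>\<^bsub>A.S\<^esub> Y2"
    if "a \<in> carrier R.S" for a
    using that y_\<iota>_commute by (auto simp: R.carrier_S \<iota>'_proj)
  ultimately show "x \<otimes>\<^bsub>A.S\<^esub> y = y \<otimes>\<^bsub>A.S\<^esub> x" using y1_y2_commute by auto
qed

sublocale A: semiclassical F A 1
  by (intro semiclassical.intro semiclassical_axioms.intro A.specialisation_axioms
      regular_A cring_A)

lemma polynomial_ring: "is_polynomial_ring2 R.S A.S \<iota>' Y1 Y2"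
  using embedding' free cring_R cring_A
  by (simp add: is_polynomial_ring2_def algebra_embedding_def)

lemma \<iota>_div_by: "x \<in> R.J \<Longrightarrow> A.h \<otimes>\<^bsub>A\<^esub> \<iota> (div_by R R.h x) = \<iota> x"
  by (simp add: R.h_div_by flip: \<iota>_h \<iota>.hom_mult)

text \<open>Since \<iota> preserves commutators and sends \<open>h\<close> to \<open>h\<close>, it
  preserves the unique quotient. On classes this makes \<open>R_1\<close> a Poisson
  subalgebra.\<close>

lemma \<iota>_d: "x \<in> carrier R \<Longrightarrow> y \<in> carrier R \<Longrightarrow> \<iota> (R.d x y) = A.d (\<iota> x) (\<iota> y)"
  using R.commutator_in_J[of x y]
  by (intro A.d_eqI[symmetric]) (auto simp: R.d_def \<iota>_div_by A.minus_eq R.minus_eq)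

lemma poisson_subalgebra: "poisson_subalgebra base_field R.S R.bracket A.S A.bracket \<iota>'"
  unfolding poisson_subalgebra_def
  using R.poisson_algebra_S A.poisson_algebra_S embedding'
  by (auto simp: R.carrier_S \<iota>'_proj R.bracket_proj A.bracket_proj \<iota>_d)

lemma bracket_y2_y1:
  "A.bracket Y2 Y1 =
    fract_eval 1 (p11 / t_minus 1) \<odot>\<^bsub>A.S\<^esub> (Y1 [^]\<^bsub>A.S\<^esub> (2::nat))
    \<oplus>\<^bsub>A.S\<^esub> fract_eval 1 ((p12 - 1) / t_minus 1) \<odot>\<^bsub>A.S\<^esub> (Y1 \<otimes>\<^bsub>A.S\<^esub> Y2)
    \<oplus>\<^bsub>A.S\<^esub> \<iota>' (R.\<gamma> (div_by R R.h (\<tau> 1))) \<otimes>\<^bsub>A.S\<^esub> Y1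
    \<oplus>\<^bsub>A.S\<^esub> \<iota>' (R.\<gamma> (div_by R R.h (\<tau> 2))) \<otimes>\<^bsub>A.S\<^esub> Y2
    \<oplus>\<^bsub>A.S\<^esub> \<iota>' (R.\<gamma> (div_by R R.h (\<tau> 0)))"
proof -
  obtain f g where f: "f \<in> F" "p11 = t_minus 1 * f" and g: "g \<in> F" "p12 - 1 = t_minus 1 * g"
    using p_near by blast
  \<comment> \<open>The statement divides in the field \<open>k(t)\<close>, where
    \<open>t - 1\<close> is nonzero; so the quotients are \<open>f\<close> and \<open>g\<close>,
    which lie in \<open>F\<close> and can be evaluated at 1.\<close>
  have "t_minus (1::'k) \<noteq> 0" by (simp add: t_minus_def)
  then have fg: "p11 / t_minus 1 = f" "(p12 - 1) / t_minus 1 = g" using f g by simp_all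
  define w where "w i = \<iota> (div_by R R.h (\<tau> i))" for i
  have w: "w i \<in> carrier A" "A.h \<otimes>\<^bsub>A\<^esub> w i = \<iota> (\<tau> i)" if "i \<in> {0, 1, 2}" for i
    using that \<tau>_near by (auto simp: w_def \<iota>_div_by)
  let ?z = "f \<odot>\<^bsub>A\<^esub> (y1 [^]\<^bsub>A\<^esub> (2::nat)) \<oplus>\<^bsub>A\<^esub> g \<odot>\<^bsub>A\<^esub> (y1 \<otimes>\<^bsub>A\<^esub> y2)
    \<oplus>\<^bsub>A\<^esub> w 1 \<otimes>\<^bsub>A\<^esub> y1 \<oplus>\<^bsub>A\<^esub> w 2 \<otimes>\<^bsub>A\<^esub> y2 \<oplus>\<^bsub>A\<^esub> w 0"
  have "A.d y2 y1 = ?z"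
  proof (rule A.d_eqI)
    have "p12 = 1 + t_minus 1 * g" using g(2) by (simp add: algebra_simps)
    then have "p12 \<odot>\<^bsub>A\<^esub> (y1 \<otimes>\<^bsub>A\<^esub> y2) = (y1 \<otimes>\<^bsub>A\<^esub> y2) \<oplus>\<^bsub>A\<^esub> A.h \<otimes>\<^bsub>A\<^esub> (g \<odot>\<^bsub>A\<^esub> (y1 \<otimes>\<^bsub>A\<^esub> y2))"
      using R.to_fract_in[of 1] g by (simp add: A.smult_l_distr A.smult_assoc R.mult_in A.h_mult)
    moreover have "p11 \<odot>\<^bsub>A\<^esub> (y1 [^]\<^bsub>A\<^esub> (2::nat)) = A.h \<otimes>\<^bsub>A\<^esub> (f \<odot>\<^bsub>A\<^esub> (y1 [^]\<^bsub>A\<^esub> (2::nat)))"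
      using f by (simp add: A.smult_assoc A.h_mult)
    \<comment> \<open>Splitting off the 1 in \<open>p12 = 1 + (t - 1) g\<close> isolates
      \<open>y1 y2\<close>; every remaining term carries a factor \<open>h\<close>.\<close>
    ultimately have "y2 \<otimes>\<^bsub>A\<^esub> y1 = A.h \<otimes>\<^bsub>A\<^esub> ?z \<oplus>\<^bsub>A\<^esub> y1 \<otimes>\<^bsub>A\<^esub> y2"
      unfolding relation using f g w
      by (simp add: A.r_distr A.a_ac flip: A.m_assoc)
    then show "A.h \<otimes>\<^bsub>A\<^esub> ?z = y2 \<otimes>\<^bsub>A\<^esub> y1 \<ominus>\<^bsub>A\<^esub> y1 \<otimes>\<^bsub>A\<^esub> y2"
      using f g w by (simp add: A.minus_eq A.a_assoc A.r_neg)
  qed (use f g w in simp)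
  then have "A.bracket Y2 Y1 = A.\<gamma> ?z" by (simp add: A.bracket_proj)
  then show ?thesis
    unfolding fg proj_y1_square using f(1) g(1) w \<tau>_near
    by (simp add: eval \<iota>'_proj w_def flip: A.proj.hom_add A.proj.hom_mult)
qed

text \<open>Subtracting the reversed product from a commutation rule changes only the diagonal
  coefficient, \<open>\<sigma> 1 1\<close> for \<open>y1\<close> and \<open>\<sigma> 2 2\<close> for
  \<open>y2\<close>, by the identity. All coefficients are then divisible by
  \<open>h\<close>.\<close>

lemma bracket_y:
  assumes "a \<in> carrier R.S"
  shows "A.bracket Y1 (\<iota>' a) =
      \<iota>' (spec_map R 1 (\<lambda>a. div_by R R.h (\<sigma> 1 1 a \<ominus>\<^bsub>R\<^esub> a)) a) \<otimes>\<^bsub>A.S\<^esub> Y1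
      \<oplus>\<^bsub>A.S\<^esub> \<iota>' (spec_map R 1 (\<lambda>a. div_by R R.h (\<sigma> 1 2 a)) a) \<otimes>\<^bsub>A.S\<^esub> Y2
      \<oplus>\<^bsub>A.S\<^esub> \<iota>' (spec_map R 1 (\<lambda>a. div_by R R.h (\<delta> 1 a)) a)" (is ?t1)
    and "A.bracket Y2 (\<iota>' a) =
      \<iota>' (spec_map R 1 (\<lambda>a. div_by R R.h (\<sigma> 2 1 a)) a) \<otimes>\<^bsub>A.S\<^esub> Y1
      \<oplus>\<^bsub>A.S\<^esub> \<iota>' (spec_map R 1 (\<lambda>a. div_by R R.h (\<sigma> 2 2 a \<ominus>\<^bsub>R\<^esub> a)) a) \<otimes>\<^bsub>A.S\<^esub> Y2
      \<oplus>\<^bsub>A.S\<^esub> \<iota>' (spec_map R 1 (\<lambda>a. div_by R R.h (\<delta> 2 a)) a)" (is ?t2)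
proof -
  obtain x where x: "x \<in> carrier R" "a = R.\<gamma> x" using assms by (auto simp: R.carrier_S)
  \<comment> \<open>Linearity of the divided map makes the induced map independent of the
    representative, so it can be computed on the chosen lift \<open>x\<close> of
    \<open>a\<close>.\<close>
  have spec: "\<iota>' (spec_map R 1 (\<lambda>a. div_by R R.h (f a)) a) = A.\<gamma> (\<iota> (div_by R R.h (f x)))"
    if "linear_endo (fract_subring F) R f" "\<And>b. b \<in> carrier R \<Longrightarrow> f b \<in> R.J" for f
    using that x R.spec_map_endo_proj[OF R.linear_endo_div_by[OF that] x(1)] by (simp add: \<iota>'_proj)
  note near = \<sigma>_near[OF x(1)] \<delta>_near[OF x(1)]
  note spec' = spec[OF R.linear_endo_minus_id[OF \<sigma>_linear[of 1 1]] \<sigma>_near(1)] spec[OF \<sigma>_linear[of 1 2] \<sigma>_near(2)]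
    spec[OF \<sigma>_linear[of 2 1] \<sigma>_near(3)] spec[OF R.linear_endo_minus_id[OF \<sigma>_linear[of 2 2]] \<sigma>_near(4)]
    spec[OF \<delta>_linear[of 1] \<delta>_near(1)] spec[OF \<delta>_linear[of 2] \<delta>_near(2)]
  have h_div: "A.h \<otimes>\<^bsub>A\<^esub> (\<iota> (div_by R R.h b) \<otimes>\<^bsub>A\<^esub> z) = \<iota> b \<otimes>\<^bsub>A\<^esub> z" if "b \<in> R.J" "z \<in> carrier A" for b z
    using that by (simp add: \<iota>_div_by flip: A.m_assoc)
  let ?z1 = "\<iota> (div_by R R.h (\<sigma> 1 1 x \<ominus>\<^bsub>R\<^esub> x)) \<otimes>\<^bsub>A\<^esub> y1 \<oplus>\<^bsub>A\<^esub> \<iota> (div_by R R.h (\<sigma> 1 2 x)) \<otimes>\<^bsub>A\<^esub> y2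
    \<oplus>\<^bsub>A\<^esub> \<iota> (div_by R R.h (\<delta> 1 x))"
  have "A.d y1 (\<iota> x) = ?z1"
  proof (rule A.d_eqI)
    have "A.h \<otimes>\<^bsub>A\<^esub> ?z1 = \<iota> (\<sigma> 1 1 x \<ominus>\<^bsub>R\<^esub> x) \<otimes>\<^bsub>A\<^esub> y1 \<oplus>\<^bsub>A\<^esub> \<iota> (\<sigma> 1 2 x) \<otimes>\<^bsub>A\<^esub> y2 \<oplus>\<^bsub>A\<^esub> \<iota> (\<delta> 1 x)"
      using near by (simp add: A.r_distr h_div \<iota>_div_by)
    also have "\<dots> = y1 \<otimes>\<^bsub>A\<^esub> \<iota> x \<ominus>\<^bsub>A\<^esub> \<iota> x \<otimes>\<^bsub>A\<^esub> y1"
      using x by (simp add: y_mult(1)[OF x(1)] R.minus_eq A.minus_eq A.l_distr A.l_minus A.a_ac)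
    finally show "A.h \<otimes>\<^bsub>A\<^esub> ?z1 = y1 \<otimes>\<^bsub>A\<^esub> \<iota> x \<ominus>\<^bsub>A\<^esub> \<iota> x \<otimes>\<^bsub>A\<^esub> y1" .
  qed (use near in simp)
  then have "A.bracket Y1 (A.\<gamma> (\<iota> x)) = A.\<gamma> ?z1" using x by (simp add: A.bracket_proj)
  then show ?t1 using near x(1) unfolding x(2) \<iota>'_proj[OF x(1)]
    by (simp add: spec'[unfolded x(2)])
  let ?z2 = "\<iota> (div_by R R.h (\<sigma> 2 1 x)) \<otimes>\<^bsub>A\<^esub> y1 \<oplus>\<^bsub>A\<^esub> \<iota> (div_by R R.h (\<sigma> 2 2 x \<ominus>\<^bsub>R\<^esub> x)) \<otimes>\<^bsub>A\<^esub> y2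
    \<oplus>\<^bsub>A\<^esub> \<iota> (div_by R R.h (\<delta> 2 x))"
  have "A.d y2 (\<iota> x) = ?z2"
  proof (rule A.d_eqI)
    have "A.h \<otimes>\<^bsub>A\<^esub> ?z2 = \<iota> (\<sigma> 2 1 x) \<otimes>\<^bsub>A\<^esub> y1 \<oplus>\<^bsub>A\<^esub> \<iota> (\<sigma> 2 2 x \<ominus>\<^bsub>R\<^esub> x) \<otimes>\<^bsub>A\<^esub> y2 \<oplus>\<^bsub>A\<^esub> \<iota> (\<delta> 2 x)"
      using near by (simp add: A.r_distr h_div \<iota>_div_by)
    also have "\<dots> = y2 \<otimes>\<^bsub>A\<^esub> \<iota> x \<ominus>\<^bsub>A\<^esub> \<iota> x \<otimes>\<^bsub>A\<^esub> y2"
      using x by (simp add: y_mult(2)[OF x(1)] R.minus_eq A.minus_eq A.l_distr A.l_minus A.a_ac)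
    finally show "A.h \<otimes>\<^bsub>A\<^esub> ?z2 = y2 \<otimes>\<^bsub>A\<^esub> \<iota> x \<ominus>\<^bsub>A\<^esub> \<iota> x \<otimes>\<^bsub>A\<^esub> y2" .
  qed (use near in simp)
  then have "A.bracket Y2 (A.\<gamma> (\<iota> x)) = A.\<gamma> ?z2" using x by (simp add: A.bracket_proj)
  then show ?t2 using near x(1) unfolding x(2) \<iota>'_proj[OF x(1)]
    by (simp add: spec'[unfolded x(2)])
qed

end

section \<open>From the standing assumption to the two claims\<close>

lemma standing_assumption_imp_double_extension_at:
  assumes SA: "standing_assumption \<Lambda> F R A \<iota> y1 y2 p11 p12 \<sigma> \<delta> \<tau>" and \<mu>: "\<mu> \<in> insert 1 \<Lambda>"
  shows "double_extension_at F R A \<mu> \<iota> y1 y2 p11 p12 \<sigma> \<delta> \<tau> (insert 1 \<Lambda>)"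
proof -
  have alg: "assoc_algebra (fract_subring F) R" "assoc_algebra (fract_subring F) A"
    using SA unfolding standing_assumption_def right_double_extension_data_def right_double_extension_def
    by blast+
  have base: "base_ring F" using SA by (auto simp: standing_assumption_def base_ring_def)
  have spec: "specialisation F R" "specialisation F A"
    using alg base by (auto simp: specialisation_def specialisation_axioms_def assoc_algebra_def)
  show ?thesis
    using SA \<mu> spec unfolding standing_assumption_def
    by (auto intro!: double_extension_at.intro double_extension_at_axioms.intro)
qed

lemma standing_assumption_imp_semiclassical:
  assumes SA: "standing_assumption \<Lambda> F R A \<iota> y1 y2 p11 p12 \<sigma> \<delta> \<tau>"
  shows "semiclassical_double_extension F R A \<iota> y1 y2 p11 p12 \<sigma> \<delta> \<tau> (insert 1 \<Lambda>)"
  using standing_assumption_imp_double_extension_at[OF SA, of 1] SA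
  unfolding standing_assumption_def
  by (intro semiclassical_double_extension.intro semiclassical_double_extension_axioms.intro) blast+

theorem theorem2p3:
  fixes \<Lambda> :: "'k::field_char_0 set" and F :: "'k poly fract set"
    and R :: "('k poly fract, 'r) module" and A :: "('k poly fract, 'a) module"
    and \<iota> :: "'r \<Rightarrow> 'a" and y1 y2 :: 'a and p11 p12 :: "'k poly fract"
    and \<sigma> :: "nat \<Rightarrow> nat \<Rightarrow> 'r \<Rightarrow> 'r" and \<delta> :: "nat \<Rightarrow> 'r \<Rightarrow> 'r" and \<tau> :: "nat \<Rightarrow> 'r"
  assumes "standing_assumption \<Lambda> F R A \<iota> y1 y2 p11 p12 \<sigma> \<delta> \<tau>"
  shows
    "(\<forall>\<mu>\<in>\<Lambda>.
        right_double_extension_data base_field (spec_algebra R \<mu>) (spec_algebra A \<mu>)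
          (spec_map A \<mu> \<iota>) (spec_proj A \<mu> y1) (spec_proj A \<mu> y2)
          (fract_eval \<mu> p11) (fract_eval \<mu> p12)
          (\<lambda>i j. spec_map R \<mu> (\<sigma> i j)) (\<lambda>i. spec_map R \<mu> (\<delta> i)) (\<lambda>i. spec_proj R \<mu> (\<tau> i)))
     \<and>
     (let R1 = spec_algebra R 1; A1 = spec_algebra A 1; \<iota>1 = spec_map A 1 \<iota>;
          hR = t_minus_in R 1; hA = t_minus_in A 1;
          brR = semiclassical_bracket R hR; brA = semiclassical_bracket A hA;
          Y1 = spec_proj A 1 y1; Y2 = spec_proj A 1 y2;
          q11 = fract_eval 1 (p11 / t_minus 1);
          q12 = fract_eval 1 ((p12 - 1) / t_minus 1);
          w = (\<lambda>i. spec_proj R 1 (div_by R hR (\<tau> i)));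
          \<alpha>11 = spec_map R 1 (\<lambda>a. div_by R hR (\<sigma> 1 1 a \<ominus>\<^bsub>R\<^esub> a));
          \<alpha>12 = spec_map R 1 (\<lambda>a. div_by R hR (\<sigma> 1 2 a));
          \<alpha>21 = spec_map R 1 (\<lambda>a. div_by R hR (\<sigma> 2 1 a));
          \<alpha>22 = spec_map R 1 (\<lambda>a. div_by R hR (\<sigma> 2 2 a \<ominus>\<^bsub>R\<^esub> a));
          \<nu>1 = spec_map R 1 (\<lambda>a. div_by R hR (\<delta> 1 a));
          \<nu>2 = spec_map R 1 (\<lambda>a. div_by R hR (\<delta> 2 a))
      in has_semiclassical_limit R hR \<and> has_semiclassical_limit A hA \<and>
         is_polynomial_ring2 R1 A1 \<iota>1 Y1 Y2 \<and>
         poisson_algebra base_field A1 brA \<and>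
         poisson_subalgebra base_field R1 brR A1 brA \<iota>1 \<and>
         brA Y2 Y1 =
           q11 \<odot>\<^bsub>A1\<^esub> (Y1 [^]\<^bsub>A1\<^esub> (2::nat)) \<oplus>\<^bsub>A1\<^esub> q12 \<odot>\<^bsub>A1\<^esub> (Y1 \<otimes>\<^bsub>A1\<^esub> Y2)
           \<oplus>\<^bsub>A1\<^esub> \<iota>1 (w 1) \<otimes>\<^bsub>A1\<^esub> Y1 \<oplus>\<^bsub>A1\<^esub> \<iota>1 (w 2) \<otimes>\<^bsub>A1\<^esub> Y2 \<oplus>\<^bsub>A1\<^esub> \<iota>1 (w 0) \<and>
         (\<forall>a\<in>carrier R1.
            brA Y1 (\<iota>1 a) =
              \<iota>1 (\<alpha>11 a) \<otimes>\<^bsub>A1\<^esub> Y1 \<oplus>\<^bsub>A1\<^esub> \<iota>1 (\<alpha>12 a) \<otimes>\<^bsub>A1\<^esub> Y2 \<oplus>\<^bsub>A1\<^esub> \<iota>1 (\<nu>1 a) \<and>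
            brA Y2 (\<iota>1 a) =
              \<iota>1 (\<alpha>21 a) \<otimes>\<^bsub>A1\<^esub> Y1 \<oplus>\<^bsub>A1\<^esub> \<iota>1 (\<alpha>22 a) \<otimes>\<^bsub>A1\<^esub> Y2 \<oplus>\<^bsub>A1\<^esub> \<iota>1 (\<nu>2 a)))"
proof -
  \<comment> \<open>This interpretation at \<mu> = 1 supplies the second claim; the first comes from
    \<open>double_extension_at\<close> at each point of \<Lambda> separately.\<close>
  interpret semiclassical_double_extension F R A \<iota> y1 y2 p11 p12 \<sigma> \<delta> \<tau> "insert 1 \<Lambda>"
    by (rule standing_assumption_imp_semiclassical[OF assms])
  show ?thesis
    unfolding Let_def
    using double_extension_at.right_double_extension_data'
        [OF standing_assumption_imp_double_extension_at[OF assms]]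
      R.has_semiclassical_limit A.has_semiclassical_limit polynomial_ring A.poisson_algebra_S
      poisson_subalgebra bracket_y2_y1 bracket_y
    by blast
qed

end
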